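(* Let $m,n\ge 1$ and $1\le k\le m$ be integers, let $\alpha\in\mathbb{R}$ and $B\in M_{m,n}$. The map $\Phi^{-}_{\alpha,B}:M_n\to M_m$, $\Phi^{-}_{\alpha,B}(X)=\alpha\,\mathrm{tr}(X)I_m-BXB^*$, is $k$-positive if and only if $\alpha\ge\sum_{j=1}^k\sigma_j(B)^2$.
   Context: $M_{m,n}$ is the set of $m\times n$ complex matrices, $M_n=M_{n,n}$. Singular values of $B$ are $\sigma_1(B)\ge\sigma_2(B)\ge\cdots\ge\sigma_{\min\{m,n\}}(B)\ge 0$, with the convention $\sigma_j(B)=0$ for $j>\min\{m,n\}$. A linear map $\Phi:M_n\to M_m$ is $k$-positive if for every positive semidefinite block matrix $[A_{ij}]_{i,j=1}^k$ with $A_{ij}\in M_n$, the block matrix $[\Phi(A_{ij})]_{i,j=1}^k$ is positive semidefinite. *)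

theory Defs
  imports
    "Jordan_Normal_Form.Char_Poly"
    "Jordan_Normal_Form.Schur_Decomposition"
    "HOL-Computational_Algebra.Polynomial"
begin

definition mat_trace :: "complex mat \<Rightarrow> complex" where
  "mat_trace A = (\<Sum>i<dim_row A. A $$ (i, i))"

(* The order on complex numbers is the one in which 0 \<le> z means that z is real and
   nonnegative; (A *\<^sub>v v) \<bullet>c v is the quadratic form v^* A v. *)
definition pos_semidef :: "complex mat \<Rightarrow> bool" where
  "pos_semidef A \<longleftrightarrow>
     square_mat A \<and> mat_adjoint A = A \<and>
     (\<forall>v \<in> carrier_vec (dim_row A). 0 \<le> (A *\<^sub>v v) \<bullet>c v)"

(* The k-by-k block matrix with n-by-n blocks A i j; block indices i, j range over {0..<k}. *)
definition block_mat :: "nat \<Rightarrow> nat \<Rightarrow> (nat \<Rightarrow> nat \<Rightarrow> complex mat) \<Rightarrow> complex mat" where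
  "block_mat k n A =
     mat (k * n) (k * n) (\<lambda>(r, c). A (r div n) (c div n) $$ (r mod n, c mod n))"

definition linear_mat_map :: "nat \<Rightarrow> nat \<Rightarrow> (complex mat \<Rightarrow> complex mat) \<Rightarrow> bool" where
  "linear_mat_map n m \<Phi> \<longleftrightarrow>
     (\<forall>X \<in> carrier_mat n n. \<Phi> X \<in> carrier_mat m m) \<and>
     (\<forall>X \<in> carrier_mat n n. \<forall>Y \<in> carrier_mat n n. \<Phi> (X + Y) = \<Phi> X + \<Phi> Y) \<and>
     (\<forall>c. \<forall>X \<in> carrier_mat n n. \<Phi> (c \<cdot>\<^sub>m X) = c \<cdot>\<^sub>m \<Phi> X)"

definition k_positive :: "nat \<Rightarrow> nat \<Rightarrow> nat \<Rightarrow> (complex mat \<Rightarrow> complex mat) \<Rightarrow> bool" where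
  "k_positive n m k \<Phi> \<longleftrightarrow>
     linear_mat_map n m \<Phi> \<and>
     (\<forall>A. (\<forall>i<k. \<forall>j<k. A i j \<in> carrier_mat n n) \<and> pos_semidef (block_mat k n A) \<longrightarrow>
          pos_semidef (block_mat k m (\<lambda>i j. \<Phi> (A i j))))"

(* Singular values are the square roots of the eigenvalues of B^* B, listed in decreasing order
   with algebraic multiplicity. These eigenvalues are real and nonnegative, so taking Re loses
   nothing. The list has dim_col B entries, of which those beyond position
   min (dim_row B) (dim_col B) vanish. *)
definition singular_values :: "complex mat \<Rightarrow> real list" where
  "singular_values B =
     rev (sorted_list_of_multiset
       (image_mset (\<lambda>z. sqrt (Re z)) (proots (char_poly (mat_adjoint B * B)))))"

(* The j-th largest singular value, counted from j = 1, and 0 outside the index range. *)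
definition singular_value :: "complex mat \<Rightarrow> nat \<Rightarrow> real" where
  "singular_value B j =
     (if 1 \<le> j \<and> j \<le> min (dim_row B) (dim_col B) then singular_values B ! (j - 1) else 0)"

definition Phi_minus :: "real \<Rightarrow> complex mat \<Rightarrow> complex mat \<Rightarrow> complex mat" where
  "Phi_minus \<alpha> B X =
     (complex_of_real \<alpha> * mat_trace X) \<cdot>\<^sub>m 1\<^sub>m (dim_row B) - B * X * mat_adjoint B"

end

theory Submission
  imports Defs
begin

text \<open>Let A be the given positive semidefinite block matrix and v = (v_1, ..., v_k) a test vector.
  Expanding the v_i in an orthonormal family e_p and transforming A to A' accordingly, the quadratic
  form of the image of A at v becomes \<alpha> tr A' - b^* A' b, where b has the blocks B^* e_p.
  Here b^* A' b \<le> |b|^2 tr A' for every positive semidefinite A', and |b|^2, the sum of the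
  |B^* e_p|^2, is at most the sum of the k largest \<sigma>_j^2 by Ky Fan's principle. Conversely, taking
  for e_p the left singular vectors and A' = b b^* turns the condition into \<alpha> S - S^2 \<ge> 0 with
  S the sum of the k largest \<sigma>_j^2; for S = 0 a unit matrix as test gives \<alpha> \<ge> 0.\<close>

section \<open>Orthonormal families of coordinate functions\<close>

text \<open>The number k enters only through the family e_p: k test blocks span at most k
  dimensions, so at most k unit vectors reach Ky Fan's principle. The step to A' rests on
  orthonormality: if v_i is the sum of C_ip e_p, then v_i^* v_j is the sum over p of conj(C_ip)
  C_jp, so the traces tr A_ij weighted by v_i^* v_j add up to tr A', where A' arises from A by the
  congruence with C on the block indices and therefore stays positive semidefinite. The obstacle is
  that the v_i may be dependent, so that fewer than k unit vectors exist; filling up with zero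
  vectors is harmless because only an upper bound on |b|^2 is wanted.

  The converse tests are the equality cases of both estimates: A' = b b^* turns b^* A' b <= |b|^2 tr
  A' into an equality, and the left singular vectors do the same for Ky Fan's bound.

  Vectors are functions on the naturals of which only the coordinates below an explicit dimension
  count. Matrices and flattened block indices appear only where the given definitions of positivity
  and singular values are translated.\<close>

definition inprod :: "nat \<Rightarrow> (nat \<Rightarrow> complex) \<Rightarrow> (nat \<Rightarrow> complex) \<Rightarrow> complex" where
  "inprod n x y = (\<Sum>i<n. x i * cnj (y i))"

definition norm_sq :: "nat \<Rightarrow> (nat \<Rightarrow> complex) \<Rightarrow> real" where
  "norm_sq n x = (\<Sum>i<n. (cmod (x i))\<^sup>2)"

lemma inprod_self: "inprod n x x = of_real (norm_sq n x)"
  by (simp add: inprod_def norm_sq_def flip: complex_norm_square)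

lemma norm_sq_nonneg: "norm_sq n x \<ge> 0"
  by (simp add: norm_sq_def sum_nonneg)

lemma norm_sq_eq_0: "norm_sq n x = 0 \<longleftrightarrow> (\<forall>i<n. x i = 0)"
  by (auto simp: norm_sq_def sum_nonneg_eq_0_iff)

lemma inprod_commute: "inprod n y x = cnj (inprod n x y)"
  by (simp add: inprod_def mult.commute)

lemma inprod_cong:
  assumes "\<And>i. i < n \<Longrightarrow> x i = x' i" "\<And>i. i < n \<Longrightarrow> y i = y' i"
  shows "inprod n x y = inprod n x' y'"
  using assms by (simp add: inprod_def)

lemma inprod_diff_left: "inprod n (\<lambda>a. x a - y a) z = inprod n x z - inprod n y z"
  by (simp add: inprod_def algebra_simps sum_subtractf)

lemma inprod_diff_right: "inprod n z (\<lambda>a. x a - y a) = inprod n z x - inprod n z y"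
  by (simp add: inprod_def algebra_simps sum_subtractf)

lemma inprod_scale_left: "inprod n (\<lambda>a. c * x a) z = c * inprod n x z"
  by (simp add: inprod_def sum_distrib_left mult.assoc)

lemma inprod_scale_right: "inprod n x (\<lambda>a. c * y a) = cnj c * inprod n x y"
  by (simp add: inprod_def sum_distrib_left mult_ac)

lemma inprod_sum_left: "inprod n (\<lambda>a. \<Sum>p\<in>S. f p a) z = (\<Sum>p\<in>S. inprod n (f p) z)"
  unfolding inprod_def sum_distrib_right by (rule sum.swap)

lemma inprod_sum_right: "inprod n z (\<lambda>a. \<Sum>p\<in>S. f p a) = (\<Sum>p\<in>S. inprod n z (f p))"
  unfolding inprod_def cnj_sum sum_distrib_left by (rule sum.swap)

text \<open>Zero vectors are admitted, so that Gram-Schmidt never has to discard a vector and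
  no index shift occurs.\<close>

definition orthonormal_or_zero :: "nat \<Rightarrow> nat \<Rightarrow> (nat \<Rightarrow> nat \<Rightarrow> complex) \<Rightarrow> bool" where
  "orthonormal_or_zero n k e \<longleftrightarrow>
     (\<forall>p<k. \<forall>q<k. p \<noteq> q \<longrightarrow> inprod n (e p) (e q) = 0) \<and>
     (\<forall>p<k. norm_sq n (e p) = 0 \<or> norm_sq n (e p) = 1)"

text \<open>A zero member has coefficient 0, any other has norm 1. Hence coefficients along
  \<open>e\<close> can be handled as if every member were a unit vector.\<close>

lemma inprod_orthonormal_or_zero_coeff:
  assumes e: "orthonormal_or_zero n k e" and p: "p < k"
  shows "inprod n x (e p) * inprod n (e p) (e p) = inprod n x (e p)"
proof (cases "norm_sq n (e p) = 0")
  case True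
  then have "inprod n x (e p) = 0"
    by (simp add: norm_sq_eq_0 inprod_def)
  then show ?thesis by simp
next
  case False
  then have "norm_sq n (e p) = 1"
    using e p by (auto simp: orthonormal_or_zero_def)
  then show ?thesis by (simp add: inprod_self)
qed

lemma inprod_projection:
  assumes e: "orthonormal_or_zero n k e" and p: "p < k"
  shows "inprod n (\<lambda>a. \<Sum>q<k. inprod n x (e q) * e q a) (e p) = inprod n x (e p)"
proof -
  have "inprod n (\<lambda>a. \<Sum>q<k. inprod n x (e q) * e q a) (e p)
      = (\<Sum>q<k. inprod n x (e q) * inprod n (e q) (e p))"
    by (simp add: inprod_sum_left inprod_scale_left)
  also have "\<dots> = (\<Sum>q<k. if q = p then inprod n x (e p) else 0)"
    using e p inprod_orthonormal_or_zero_coeff[OF e p]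
    by (intro sum.cong) (auto simp: orthonormal_or_zero_def)
  finally show ?thesis using p by simp
qed

text \<open>Since \<open>P\<close> is the projection of \<open>x\<close>, the products of
  \<open>P\<close> with \<open>P\<close> and of \<open>x\<close> with \<open>P\<close> agree, and
  the squared norm of the residual \<open>x - P\<close> is exactly the difference of the two
  sides.\<close>

lemma bessel:
  assumes e: "orthonormal_or_zero n k e"
  shows "(\<Sum>p<k. (cmod (inprod n x (e p)))\<^sup>2) \<le> norm_sq n x"
proof -
  define P where "P = (\<lambda>a. \<Sum>q<k. inprod n x (e q) * e q a)"
  have xP: "inprod n x P = of_real (\<Sum>p<k. (cmod (inprod n x (e p)))\<^sup>2)"
    unfolding P_def inprod_sum_right inprod_scale_right
    by (simp add: mult.commute flip: complex_norm_square)
  have "inprod n P P = (\<Sum>q<k. inprod n x (e q) * inprod n (e q) P)"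
    by (subst (1) P_def) (simp add: inprod_sum_left inprod_scale_left)
  also have "\<dots> = (\<Sum>q<k. inprod n x (e q) * cnj (inprod n x (e q)))"
    using inprod_projection[OF e, of _ x] inprod_commute[of n "e _" P]
    by (intro sum.cong refl) (simp add: P_def)
  finally have PP: "inprod n P P = inprod n x P"
    by (simp add: xP flip: complex_norm_square)
  have "of_real (norm_sq n (\<lambda>a. x a - P a)) = inprod n (\<lambda>a. x a - P a) (\<lambda>a. x a - P a)"
    by (simp add: inprod_self)
  also have "\<dots> = inprod n x x - inprod n P x"
    by (simp add: inprod_diff_left inprod_diff_right PP)
  also have "\<dots> = of_real (norm_sq n x - (\<Sum>p<k. (cmod (inprod n x (e p)))\<^sup>2))"
    by (simp add: xP inprod_self inprod_commute[of n P x])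
  finally have "norm_sq n (\<lambda>a. x a - P a) = norm_sq n x - (\<Sum>p<k. (cmod (inprod n x (e p)))\<^sup>2)"
    using of_real_eq_iff by blast
  then show ?thesis
    using norm_sq_nonneg[of n "\<lambda>a. x a - P a"] by simp
qed

text \<open>The input may be dependent or longer than the dimension: a vector in the span of its
  predecessors contributes a zero member. The triangular range \<open>p \<le> i\<close> records that
  the flag is preserved, which the spectral theorem relies on.\<close>

lemma gram_schmidt_orthonormal_or_zero:
  fixes v :: "nat \<Rightarrow> nat \<Rightarrow> complex"
  obtains e where "orthonormal_or_zero n k e"
    "\<And>i a. i < k \<Longrightarrow> a < n \<Longrightarrow> v i a = (\<Sum>p\<le>i. inprod n (v i) (e p) * e p a)"
proof -
  have "\<exists>e. orthonormal_or_zero n k e \<and>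
      (\<forall>i<k. \<forall>a<n. v i a = (\<Sum>p\<le>i. inprod n (v i) (e p) * e p a))"
  proof (induction k)
    case 0
    then show ?case by (simp add: orthonormal_or_zero_def)
  next
    case (Suc k)
    then obtain e where e: "orthonormal_or_zero n k e"
      and ve: "\<forall>i<k. \<forall>a<n. v i a = (\<Sum>p\<le>i. inprod n (v i) (e p) * e p a)"
      by blast
    define P where "P = (\<lambda>a. \<Sum>q<k. inprod n (v k) (e q) * e q a)"
    define r where "r = (\<lambda>a. v k a - P a)"
    \<comment> \<open>For a vanishing residual \<open>s\<close> is the inverse of 0, which is 0, so
      the new member \<open>w\<close> becomes the zero vector without a case distinction.\<close>
    define s where "s = complex_of_real (inverse (sqrt (norm_sq n r)))"
    have s_real: "cnj s = s" by (simp add: s_def)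
    define w where "w = (\<lambda>a. s * r a)"
    define e' where "e' = e(k := w)"
    have re: "inprod n r (e p) = 0" if "p < k" for p
      using inprod_projection[OF e that] by (simp add: r_def inprod_diff_left P_def)
    then have we: "inprod n w (e p) = 0" if "p < k" for p
      using that by (simp add: w_def inprod_scale_left)
    have "inprod n r P = 0"
      by (simp add: P_def inprod_sum_right inprod_scale_right re)
    moreover have "inprod n r r = inprod n (v k) r - inprod n P r"
      by (subst (1) r_def) (rule inprod_diff_left)
    \<comment> \<open>The part \<open>P\<close> of \<open>v k\<close> is orthogonal to
      \<open>r\<close>, so the coefficient of \<open>v k\<close> along \<open>w\<close> is the one
      of \<open>r\<close> itself, and the new summand restores exactly \<open>r\<close>.\<close>
    ultimately have vr: "inprod n (v k) r = inprod n r r"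
      by (simp add: inprod_commute[of n P r])
    have nw: "norm_sq n w = (inverse (sqrt (norm_sq n r)))\<^sup>2 * norm_sq n r"
      by (simp add: norm_sq_def w_def s_def norm_mult norm_inverse power_mult_distrib
          sum_nonneg flip: sum_distrib_left)
    have nw01: "norm_sq n w = 0 \<or> norm_sq n w = 1"
      by (cases "norm_sq n r = 0") (simp_all add: nw power_inverse norm_sq_nonneg)
    have orth: "orthonormal_or_zero n (Suc k) e'"
      using e we nw01
      by (auto simp: orthonormal_or_zero_def e'_def less_Suc_eq inprod_commute[of n "e _" w])
    have wr: "inprod n (v k) w * w a = r a" if "a < n" for a
    proof (cases "norm_sq n r = 0")
      case True
      then show ?thesis using that by (simp add: w_def norm_sq_eq_0)
    next
      case False
      then have "s * s * of_real (norm_sq n r) = 1"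
        using norm_sq_nonneg[of n r]
        by (simp add: s_def field_simps flip: of_real_mult)
      then show ?thesis
        using s_real by (simp add: w_def inprod_scale_right vr inprod_self mult_ac)
    qed
    have "v i a = (\<Sum>p\<le>i. inprod n (v i) (e' p) * e' p a)" if "i < Suc k" "a < n" for i a
    proof (cases "i = k")
      case True
      have "(\<Sum>p\<le>k. inprod n (v k) (e' p) * e' p a) = P a + inprod n (v k) w * w a"
        by (simp add: e'_def P_def flip: lessThan_Suc_atMost)
      then show ?thesis using True wr[OF \<open>a < n\<close>] by (simp add: r_def)
    next
      case False
      then show ?thesis using ve that by (simp add: e'_def)
    qed
    with orth show ?case by blast
  qed
  then show thesis using that by blast
qed

section \<open>Spectral theorem for Hermitian matrices\<close>

definition orthonormal_basis :: "nat \<Rightarrow> (nat \<Rightarrow> nat \<Rightarrow> complex) \<Rightarrow> bool" where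
  "orthonormal_basis n e \<longleftrightarrow> (\<forall>i<n. \<forall>j<n. inprod n (e i) (e j) = (if i = j then 1 else 0))"

lemma index_mult_mat_sum:
  assumes "A \<in> carrier_mat m n" "B \<in> carrier_mat n l" "i < m" "j < l"
  shows "(A * B) $$ (i, j) = (\<Sum>b<n. A $$ (i, b) * B $$ (b, j))"
  using assms by (simp add: scalar_prod_def atLeast0LessThan)

text \<open>Orthonormality says that \<open>F\<close> is a left inverse of the square matrix
  \<open>E\<close>. It is then also a right inverse, and this second identity is
  completeness.\<close>

lemma orthonormal_basis_expansion:
  assumes e: "orthonormal_basis n e" and a: "a < n"
  shows "(\<Sum>j<n. inprod n x (e j) * e j a) = x a"
proof -
  define E where "E = mat n n (\<lambda>(a, p). e p a)"
  define F where "F = mat n n (\<lambda>(p, a). cnj (e p a))"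
  have carr: "E \<in> carrier_mat n n" "F \<in> carrier_mat n n"
    by (simp_all add: E_def F_def)
  have "F * E = 1\<^sub>m n"
  proof (rule eq_matI)
    fix p q assume pq: "p < dim_row (1\<^sub>m n)" "q < dim_col (1\<^sub>m n)"
    then have "(F * E) $$ (p, q) = inprod n (e q) (e p)"
      by (subst index_mult_mat_sum[OF carr(2,1)]) (simp_all add: E_def F_def inprod_def mult.commute)
    then show "(F * E) $$ (p, q) = 1\<^sub>m n $$ (p, q)"
      using e pq by (auto simp: orthonormal_basis_def)
  qed (use carr in auto)
  then have EF: "E * F = 1\<^sub>m n"
    using mat_mult_left_right_inverse carr by blast
  have delta: "(\<Sum>p<n. e p a * cnj (e p b)) = (if a = b then 1 else 0)" if "b < n" for b
  proof -
    have "(\<Sum>p<n. e p a * cnj (e p b)) = (E * F) $$ (a, b)"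
      using that a by (subst index_mult_mat_sum[OF carr]) (simp_all add: E_def F_def)
    then show ?thesis using that a by (simp add: EF)
  qed
  have "(\<Sum>j<n. inprod n x (e j) * e j a) = (\<Sum>j<n. \<Sum>b<n. x b * (e j a * cnj (e j b)))"
    unfolding inprod_def sum_distrib_right by (intro sum.cong refl) (simp add: mult_ac)
  also have "\<dots> = (\<Sum>b<n. x b * (\<Sum>j<n. e j a * cnj (e j b)))"
    unfolding sum_distrib_left by (rule sum.swap)
  also have "\<dots> = (\<Sum>b<n. if a = b then x b else 0)"
    by (intro sum.cong) (auto simp: delta)
  finally show ?thesis using a by simp
qed

lemma parseval:
  assumes "orthonormal_basis n e"
  shows "norm_sq n x = (\<Sum>j<n. (cmod (inprod n x (e j)))\<^sup>2)"
proof -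
  have "of_real (norm_sq n x) = inprod n (\<lambda>a. \<Sum>j<n. inprod n x (e j) * e j a) x"
    unfolding inprod_self[symmetric]
    by (rule inprod_cong) (simp_all add: orthonormal_basis_expansion[OF assms])
  also have "\<dots> = (\<Sum>j<n. inprod n x (e j) * cnj (inprod n x (e j)))"
    by (simp add: inprod_sum_left inprod_scale_left inprod_commute[of n "e _" x])
  also have "\<dots> = of_real (\<Sum>j<n. (cmod (inprod n x (e j)))\<^sup>2)"
    by (simp flip: complex_norm_square)
  finally show ?thesis using of_real_eq_iff by blast
qed

text \<open>The Schur decomposition of the library only provides an invertible P with A P = P T.
  Gram-Schmidt on the columns of P keeps the flag they span, hence keeps A triangular with the
  same diagonal, and a triangular Hermitian matrix is diagonal.\<close>

lemma hermitian_eigenbasis: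
  fixes A :: "complex mat"
  assumes A: "A \<in> carrier_mat n n"
    and herm: "\<And>i j. i < n \<Longrightarrow> j < n \<Longrightarrow> A $$ (j, i) = cnj (A $$ (i, j))"
    and cp: "char_poly A = (\<Prod>e\<leftarrow>es. [:- e, 1:])"
  obtains u where "orthonormal_basis n u"
    "\<And>j a. j < n \<Longrightarrow> a < n \<Longrightarrow> (\<Sum>b<n. A $$ (a, b) * u j b) = es ! j * u j a"
proof -
  obtain T P Q where schur: "schur_decomposition A es = (T, P, Q)"
    by (cases "schur_decomposition A es") auto
  have sim: "similar_mat_wit A T P Q" and ut: "upper_triangular T" and dT: "diag_mat T = es"
    using schur_decomposition[OF A cp schur] by auto
  have T: "T \<in> carrier_mat n n" and P: "P \<in> carrier_mat n n" and Q: "Q \<in> carrier_mat n n"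
    and PQ: "P * Q = 1\<^sub>m n" and QP: "Q * P = 1\<^sub>m n" and APTQ: "A = P * T * Q"
    using similar_mat_witD2[OF A sim] by auto
  have Tes: "T $$ (j, j) = es ! j" if "j < n" for j
    using that T dT by (auto simp: diag_mat_def)
  have AP: "A * P = P * T"
  proof -
    have "A * P = P * T * (Q * P)"
      unfolding APTQ using P T Q by (simp add: assoc_mult_mat[of _ n n _ n _ n])
    then show ?thesis using P T by (simp add: QP)
  qed
  define v where "v = (\<lambda>j a. P $$ (a, j))"
  define L where "L = (\<lambda>x a. \<Sum>b<n. A $$ (a, b) * x b)"
  have Lv: "L (v j) a = (\<Sum>i\<le>j. T $$ (i, j) * v i a)" if "j < n" "a < n" for j a
  proof -
    have "L (v j) a = (P * T) $$ (a, j)"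
      using that by (simp add: L_def v_def index_mult_mat_sum[OF A P] flip: AP)
    also have "\<dots> = (\<Sum>i<n. T $$ (i, j) * v i a)"
      using that by (simp add: index_mult_mat_sum[OF P T] v_def mult.commute)
    also have "\<dots> = (\<Sum>i\<le>j. T $$ (i, j) * v i a)"
      using that T ut by (intro sum.mono_neutral_right) (auto simp: upper_triangular_def)
    finally show ?thesis .
  qed
  obtain e where e: "orthonormal_or_zero n n e"
    and ve: "\<And>i a. i < n \<Longrightarrow> a < n \<Longrightarrow> v i a = (\<Sum>p\<le>i. inprod n (v i) (e p) * e p a)"
    using gram_schmidt_orthonormal_or_zero[of n n v] by blast
  define c where "c = (\<lambda>i p. inprod n (v i) (e p))"
  \<comment> \<open>\<open>P = E * C\<close> below is a QR factorization. As \<open>P\<close> is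
    invertible, the triangular factor \<open>C\<close> has no zero on its diagonal, so Gram-Schmidt
    produced no zero vector and \<open>e\<close> is a genuine basis.\<close>
  have c_nz: "c i i \<noteq> 0" if "i < n" for i
  proof -
    define E where "E = mat n n (\<lambda>(a, p). e p a)"
    define C where "C = mat n n (\<lambda>(p, i). if p \<le> i then c i p else 0)"
    have carr: "E \<in> carrier_mat n n" "C \<in> carrier_mat n n"
      by (simp_all add: E_def C_def)
    have "P = E * C"
    proof (rule eq_matI)
      fix a i assume "a < dim_row (E * C)" "i < dim_col (E * C)"
      then have ai: "a < n" "i < n" using carr by auto
      have "(E * C) $$ (a, i) = (\<Sum>p<n. if p \<le> i then c i p * e p a else 0)"
        unfolding index_mult_mat_sum[OF carr ai] using ai
        by (intro sum.cong) (auto simp: E_def C_def)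
      also have "\<dots> = (\<Sum>p\<le>i. c i p * e p a)"
        using ai by (subst sum.mono_neutral_right[of "{..<n}" "{..i}"]) auto
      also have "\<dots> = P $$ (a, i)" using ve[OF ai(2,1)] by (simp add: c_def v_def)
      finally show "P $$ (a, i) = (E * C) $$ (a, i)" by simp
    qed (use P carr in auto)
    moreover have "det P * det Q = 1"
      using det_mult[OF P Q] by (simp add: PQ)
    ultimately have "det E * det C * det Q = 1"
      using det_mult[OF carr] by simp
    then have "det C \<noteq> 0" by auto
    moreover have "upper_triangular C"
      by (auto simp: upper_triangular_def C_def)
    ultimately have "0 \<notin> set (diag_mat C)"
      using det_upper_triangular[OF _ carr(2)] by (simp add: prod_list_zero_iff)
    then show ?thesis using that carr(2) by (force simp: diag_mat_def C_def)
  qed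
  have e_norm: "inprod n (e i) (e i) = 1" if "i < n" for i
    using inprod_orthonormal_or_zero_coeff[OF e that, of "v i"] c_nz[OF that] by (simp add: c_def)
  then have basis: "orthonormal_basis n e"
    using e by (auto simp: orthonormal_basis_def orthonormal_or_zero_def)
  have ve_ip: "inprod n (v l) (e i) = 0" if "l < i" "i < n" for l i
  proof -
    have "inprod n (v l) (e i) = inprod n (\<lambda>a. \<Sum>p\<le>l. c l p * e p a) (e i)"
      using that ve[of l] by (intro inprod_cong) (auto simp: c_def)
    also have "\<dots> = (\<Sum>p\<le>l. c l p * inprod n (e p) (e i))"
      by (simp add: inprod_sum_left inprod_scale_left)
    also have "\<dots> = 0"
      using that basis by (intro sum.neutral) (auto simp: orthonormal_basis_def)
    finally show ?thesis .
  qed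
  \<comment> \<open>In the basis \<open>e\<close> the operator is still triangular with the diagonal
    of \<open>T\<close>. To see this, the image of \<open>v j\<close> is expanded once through
    \<open>T\<close> and once through the \<open>e p\<close> with \<open>p \<le> j\<close>; the
    induction hypothesis removes all \<open>p < j\<close>, and \<open>c j j\<close> cancels.\<close>
  have lower: "inprod n (L (e j)) (e i) = (if i = j then T $$ (j, j) else 0)"
    if "j \<le> i" "i < n" for i j
    using that
  proof (induction j arbitrary: i rule: less_induct)
    case (less j)
    then have j: "j < n" by simp
    have "inprod n (L (v j)) (e i) = inprod n (\<lambda>a. \<Sum>l\<le>j. T $$ (l, j) * v l a) (e i)"
      using Lv[OF j] by (intro inprod_cong) auto
    also have "\<dots> = (\<Sum>l\<le>j. T $$ (l, j) * inprod n (v l) (e i))"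
      by (simp add: inprod_sum_left inprod_scale_left)
    also have "\<dots> = (\<Sum>l\<le>j. if l = i then T $$ (i, j) * c i i else 0)"
      using less.prems ve_ip by (intro sum.cong) (auto simp: c_def)
    also have "\<dots> = (if i = j then T $$ (j, j) * c j j else 0)"
      using less.prems by auto
    finally have 1: "inprod n (L (v j)) (e i) = (if i = j then T $$ (j, j) * c j j else 0)" .
    have "L (v j) a = (\<Sum>p\<le>j. c j p * L (e p) a)" for a
    proof -
      have "L (v j) a = (\<Sum>b<n. A $$ (a, b) * (\<Sum>p\<le>j. c j p * e p b))"
        unfolding L_def using ve[OF j] by (intro sum.cong) (auto simp: c_def)
      also have "\<dots> = (\<Sum>b<n. \<Sum>p\<le>j. c j p * (A $$ (a, b) * e p b))"
        by (simp add: sum_distrib_left mult_ac)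
      also have "\<dots> = (\<Sum>p\<le>j. c j p * L (e p) a)"
        unfolding L_def sum_distrib_left by (rule sum.swap)
      finally show ?thesis .
    qed
    then have "L (v j) = (\<lambda>a. \<Sum>p\<le>j. c j p * L (e p) a)" by blast
    then have "inprod n (L (v j)) (e i) = (\<Sum>p\<le>j. c j p * inprod n (L (e p)) (e i))"
      by (simp add: inprod_sum_left inprod_scale_left)
    also have "\<dots> = (\<Sum>p\<le>j. if p = j then c j j * inprod n (L (e j)) (e i) else 0)"
      using less.IH less.prems by (intro sum.cong) auto
    finally have "inprod n (L (v j)) (e i) = c j j * inprod n (L (e j)) (e i)" by simp
    with 1 c_nz[OF j] show ?case by (auto split: if_splits)
  qed
  have L_adj: "inprod n (L x) y = inprod n x (L y)" for x y
  proof -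
    have "inprod n (L x) y = (\<Sum>a<n. \<Sum>b<n. A $$ (a, b) * x b * cnj (y a))"
      by (simp add: inprod_def L_def sum_distrib_right)
    also have "\<dots> = (\<Sum>b<n. \<Sum>a<n. A $$ (a, b) * x b * cnj (y a))"
      by (rule sum.swap)
    also have "\<dots> = inprod n x (L y)"
      unfolding inprod_def L_def cnj_sum sum_distrib_left
    proof (intro sum.cong refl)
      fix b a assume "b \<in> {..<n}" "a \<in> {..<n}"
      then have "cnj (A $$ (b, a)) = A $$ (a, b)" using herm[of b a] by simp
      then show "A $$ (a, b) * x b * cnj (y a) = x b * cnj (A $$ (b, a) * y a)"
        by simp
    qed
    finally show ?thesis .
  qed
  have diag: "inprod n (L (e j)) (e i) = (if i = j then es ! j else 0)" if "i < n" "j < n" for i j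
  proof (cases "j \<le> i")
    case True
    then show ?thesis using lower that Tes by simp
  next
    case False
    then have "inprod n (L (e i)) (e j) = 0" using lower that by simp
    then show ?thesis
      using False L_adj[of "e j" "e i"] inprod_commute[of n "e j" "L (e i)"] by simp
  qed
  have "L (e j) a = es ! j * e j a" if "j < n" "a < n" for j a
  proof -
    have "L (e j) a = (\<Sum>i<n. inprod n (L (e j)) (e i) * e i a)"
      using orthonormal_basis_expansion[OF basis that(2), of "L (e j)"] by simp
    also have "\<dots> = (\<Sum>i<n. if i = j then es ! j * e j a else 0)"
      using that diag by (intro sum.cong) auto
    finally show ?thesis using that by simp
  qed
  with basis show thesis using that unfolding L_def by blast
qed

section \<open>Quadratic forms of block matrices\<close>

text \<open>Relative to the threshold \<open>\<mu>\<close>, coefficients before position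
  \<open>k\<close> are nonnegative and gain from weight 1, later ones are nonpositive and gain from
  weight 0. The shift by \<open>\<mu>\<close> costs at most \<open>\<mu>\<close> times
  \<open>k\<close>, which the right-hand side returns.\<close>

lemma weighted_sum_le_sum_largest:
  fixes lam t :: "nat \<Rightarrow> real"
  assumes anti: "antimono lam" and nonneg: "\<And>j. lam j \<ge> 0"
    and t: "\<And>j. j < n \<Longrightarrow> 0 \<le> t j" "\<And>j. j < n \<Longrightarrow> t j \<le> 1"
    and sum_t: "(\<Sum>j<n. t j) \<le> real k"
  shows "(\<Sum>j<n. lam j * t j) \<le> (\<Sum>j<k. lam j)"
proof -
  \<comment> \<open>Counting starts at 0, so this is the largest value outside the first
    \<open>k\<close>.\<close>
  define \<mu> where "\<mu> = lam k"
  have "(\<Sum>j<n. lam j * t j) = (\<Sum>j<n. (lam j - \<mu>) * t j) + \<mu> * (\<Sum>j<n. t j)"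
    by (simp add: algebra_simps sum_subtractf sum_distrib_left)
  also have "\<mu> * (\<Sum>j<n. t j) \<le> \<mu> * real k"
    using sum_t nonneg by (simp add: \<mu>_def mult_left_mono)
  also have "(\<Sum>j<n. (lam j - \<mu>) * t j) \<le> (\<Sum>j<n. if j < k then lam j - \<mu> else 0)"
  proof (rule sum_mono)
    fix j assume "j \<in> {..<n}"
    then have tj: "0 \<le> t j" "t j \<le> 1" using t by auto
    show "(lam j - \<mu>) * t j \<le> (if j < k then lam j - \<mu> else 0)"
    proof (cases "j < k")
      case True
      then have "\<mu> \<le> lam j" using anti by (simp add: \<mu>_def antimonoD)
      then show ?thesis using True tj by (simp add: mult_left_le)
    next
      case False
      then have "lam j \<le> \<mu>" using anti by (simp add: \<mu>_def antimonoD)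
      then show ?thesis using False tj by (simp add: mult_nonpos_nonneg)
    qed
  qed
  also have "(\<Sum>j<n. if j < k then lam j - \<mu> else 0) = (\<Sum>j\<in>{..<n} \<inter> {..<k}. lam j - \<mu>)"
    by (simp add: sum.inter_restrict)
  \<comment> \<open>This covers \<open>n < k\<close>: the added terms are nonnegative.\<close>
  also have "\<dots> \<le> (\<Sum>j<k. lam j - \<mu>)"
    using anti by (intro sum_mono2) (auto simp: \<mu>_def antimonoD)
  finally show ?thesis by (simp add: sum_subtractf mult.commute)
qed

text \<open>The index set is arbitrary so that pairs (block, coordinate) can serve as row
  indices.\<close>

definition psd_form :: "'a set \<Rightarrow> ('a \<Rightarrow> 'a \<Rightarrow> complex) \<Rightarrow> bool" where
  "psd_form I A \<longleftrightarrow> (\<forall>w. 0 \<le> (\<Sum>x\<in>I. \<Sum>y\<in>I. cnj (w x) * A x y * w y))"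

text \<open>A replacement for diagonalising A: sum the quadratic form over the vectors
  cnj (b y) 1_x - cnj (b x) 1_y for all x and y.\<close>

lemma psd_form_le_trace:
  assumes fin: "finite I" and psd: "psd_form I A"
  shows "(\<Sum>x\<in>I. \<Sum>y\<in>I. cnj (b x) * A x y * b y)
    \<le> of_real (\<Sum>x\<in>I. (cmod (b x))\<^sup>2) * (\<Sum>x\<in>I. A x x)"
proof -
  \<comment> \<open>This is the form at the vector \<open>w\<close> chosen below. For
    \<open>x = y\<close> that vector is 0 and so is \<open>q x x\<close>, so the diagonal needs no
    separate treatment.\<close>
  define q where "q = (\<lambda>x y. b y * cnj (b y) * A x x + b x * cnj (b x) * A y y
    - cnj (b x) * A x y * b y - cnj (b y) * A y x * b x)"
  define F where "F = (\<Sum>x\<in>I. \<Sum>y\<in>I. cnj (b x) * A x y * b y)"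
  define N where "N = (\<Sum>x\<in>I. b x * cnj (b x))"
  have q_nonneg: "0 \<le> q x y" if x: "x \<in> I" and y: "y \<in> I" for x y
  proof -
    define w where "w = (\<lambda>z. (if z = x then cnj (b y) else 0) - (if z = y then cnj (b x) else 0))"
    have row: "(\<Sum>z'\<in>I. cnj (w z) * A z z' * w z') = cnj (w z) * (A z x * cnj (b y) - A z y * cnj (b x))" for z
    proof -
      have "(\<Sum>z'\<in>I. cnj (w z) * A z z' * w z')
          = cnj (w z) * (\<Sum>z'\<in>I. (if z' = x then A z x * cnj (b y) else 0) - (if z' = y then A z y * cnj (b x) else 0))"
        unfolding sum_distrib_left by (intro sum.cong refl) (auto simp: w_def algebra_simps)
      then show ?thesis using x y fin by (simp add: sum_subtractf)
    qed
    have "(\<Sum>z\<in>I. \<Sum>z'\<in>I. cnj (w z) * A z z' * w z')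
        = (\<Sum>z\<in>I. (if z = x then b y * (A x x * cnj (b y) - A x y * cnj (b x)) else 0)
            - (if z = y then b x * (A y x * cnj (b y) - A y y * cnj (b x)) else 0))"
      unfolding row by (intro sum.cong refl) (auto simp: w_def algebra_simps)
    also have "\<dots> = q x y"
      using x y fin by (simp add: sum_subtractf q_def algebra_simps)
    finally show ?thesis
      using psd[unfolded psd_form_def, rule_format, of w] by simp
  qed
  have "(\<Sum>x\<in>I. \<Sum>y\<in>I. b y * cnj (b y) * A x x) = N * (\<Sum>x\<in>I. A x x)"
    unfolding N_def by (subst sum.swap) (simp add: sum_product)
  moreover have "(\<Sum>x\<in>I. \<Sum>y\<in>I. b x * cnj (b x) * A y y) = N * (\<Sum>x\<in>I. A x x)"
    unfolding N_def by (simp add: sum_product)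
  moreover have "(\<Sum>x\<in>I. \<Sum>y\<in>I. cnj (b y) * A y x * b x) = F"
    unfolding F_def by (rule sum.swap)
  moreover have "(\<Sum>x\<in>I. \<Sum>y\<in>I. cnj (b x) * A x y * b y) = F"
    by (simp add: F_def)
  \<comment> \<open>An identity of Lagrange type: the defect of the claimed inequality is half the
    sum of the nonnegative numbers \<open>q x y\<close>.\<close>
  ultimately have "(\<Sum>x\<in>I. \<Sum>y\<in>I. q x y) = 2 * (N * (\<Sum>x\<in>I. A x x) - F)"
    unfolding q_def sum_subtractf sum.distrib by simp
  moreover have "0 \<le> (\<Sum>x\<in>I. \<Sum>y\<in>I. q x y)"
    by (intro sum_nonneg q_nonneg)
  moreover have "0 \<le> z" if "0 \<le> 2 * z" for z :: complex
    using that by (simp add: less_eq_complex_def)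
  ultimately have "F \<le> N * (\<Sum>x\<in>I. A x x)"
    by (metis diff_ge_0_iff_ge)
  moreover have "N = of_real (\<Sum>x\<in>I. (cmod (b x))\<^sup>2)"
    by (simp add: N_def flip: complex_norm_square)
  ultimately show ?thesis unfolding F_def by metis
qed

lemma psd_form_diag:
  assumes fin: "finite I" and psd: "psd_form I A" and x: "x \<in> I"
  shows "0 \<le> A x x"
proof -
  define w where "w = (\<lambda>z. if z = x then 1 else (0::complex))"
  have "0 \<le> (\<Sum>y\<in>I. \<Sum>z\<in>I. cnj (w y) * A y z * w z)"
    using psd unfolding psd_form_def by blast
  also have "\<dots> = (\<Sum>y\<in>I. \<Sum>z\<in>I. if z = x then if y = x then A x x else 0 else 0)"
    by (intro sum.cong) (auto simp: w_def)
  finally show ?thesis using fin x by simp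
qed

lemma sum_swap_pairs:
  "(\<Sum>a\<in>S. \<Sum>b\<in>T. \<Sum>c\<in>U. \<Sum>d\<in>V. g a b c d) = (\<Sum>c\<in>U. \<Sum>d\<in>V. \<Sum>a\<in>S. \<Sum>b\<in>T. g a b c d)"
proof -
  have "(\<Sum>a\<in>S. \<Sum>b\<in>T. \<Sum>c\<in>U. \<Sum>d\<in>V. g a b c d) = (\<Sum>a\<in>S. \<Sum>c\<in>U. \<Sum>b\<in>T. \<Sum>d\<in>V. g a b c d)"
    by (intro sum.cong refl sum.swap)
  also have "\<dots> = (\<Sum>c\<in>U. \<Sum>a\<in>S. \<Sum>d\<in>V. \<Sum>b\<in>T. g a b c d)"
    by (subst sum.swap) (intro sum.cong refl sum.swap)
  also have "\<dots> = (\<Sum>c\<in>U. \<Sum>d\<in>V. \<Sum>a\<in>S. \<Sum>b\<in>T. g a b c d)"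
    by (intro sum.cong refl sum.swap)
  finally show ?thesis .
qed

text \<open>Moves the outer factors of B M B^* onto the arguments. It serves twice: for the term B X
  B^* of the map, and for the change of coefficients on block indices.\<close>

lemma sandwich_form:
  "(\<Sum>a\<in>S. \<Sum>b\<in>S. cnj (x a) * (\<Sum>c\<in>T. \<Sum>d\<in>T. B a c * M c d * cnj (B b d)) * y b)
   = (\<Sum>c\<in>T. \<Sum>d\<in>T. cnj (\<Sum>a\<in>S. cnj (B a c) * x a) * M c d * (\<Sum>b\<in>S. cnj (B b d) * y b))"
proof -
  have prod: "(\<Sum>a\<in>S. f a) * m * (\<Sum>b\<in>S. g b) = (\<Sum>a\<in>S. \<Sum>b\<in>S. f a * m * g b)"
    for f g :: "'a \<Rightarrow> complex" and m
    by (subst sum_distrib_right) (rule sum_product)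
  have "(\<Sum>a\<in>S. \<Sum>b\<in>S. cnj (x a) * (\<Sum>c\<in>T. \<Sum>d\<in>T. B a c * M c d * cnj (B b d)) * y b)
    = (\<Sum>a\<in>S. \<Sum>b\<in>S. \<Sum>c\<in>T. \<Sum>d\<in>T. (B a c * cnj (x a)) * M c d * (cnj (B b d) * y b))"
    by (simp add: sum_distrib_left sum_distrib_right mult_ac)
  also have "\<dots> = (\<Sum>c\<in>T. \<Sum>d\<in>T. \<Sum>a\<in>S. \<Sum>b\<in>S. (B a c * cnj (x a)) * M c d * (cnj (B b d) * y b))"
    by (rule sum_swap_pairs)
  also have "\<dots> = (\<Sum>c\<in>T. \<Sum>d\<in>T. cnj (\<Sum>a\<in>S. cnj (B a c) * x a) * M c d * (\<Sum>b\<in>S. cnj (B b d) * y b))"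
    by (simp add: prod)
  finally show ?thesis .
qed

text \<open>\<open>A i j c d\<close> stands for entry (c, d) of block (i, j). Keeping the block
  indices together and the coordinate indices together lets \<open>sum_swap_pairs\<close> isolate a
  transformation that acts on one kind only.\<close>

definition block_form ::
    "nat \<Rightarrow> nat \<Rightarrow> (nat \<Rightarrow> nat \<Rightarrow> nat \<Rightarrow> nat \<Rightarrow> complex) \<Rightarrow> (nat \<Rightarrow> nat \<Rightarrow> complex) \<Rightarrow> complex" where
  "block_form k n A w = (\<Sum>i<k. \<Sum>j<k. \<Sum>c<n. \<Sum>d<n. cnj (w i c) * A i j c d * w j d)"

lemma block_form_cong:
  assumes "\<And>i j c d. i < k \<Longrightarrow> j < k \<Longrightarrow> c < n \<Longrightarrow> d < n \<Longrightarrow> A i j c d = A' i j c d"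
    "\<And>i c. i < k \<Longrightarrow> c < n \<Longrightarrow> w i c = w' i c"
  shows "block_form k n A w = block_form k n A' w'"
  unfolding block_form_def using assms by (intro sum.cong refl) simp_all

lemma sum_Times: "(\<Sum>x\<in>S \<times> T. f x) = (\<Sum>i\<in>S. \<Sum>c\<in>T. f (i, c))"
  by (simp add: sum.cartesian_product)

lemma block_form_pairs:
  "(\<Sum>x\<in>{..<k}\<times>{..<n}. \<Sum>y\<in>{..<k}\<times>{..<n}.
      cnj (w (fst x) (snd x)) * A (fst x) (fst y) (snd x) (snd y) * w (fst y) (snd y))
    = block_form k n A w"
proof -
  have "(\<Sum>x\<in>{..<k}\<times>{..<n}. \<Sum>y\<in>{..<k}\<times>{..<n}.
      cnj (w (fst x) (snd x)) * A (fst x) (fst y) (snd x) (snd y) * w (fst y) (snd y))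
    = (\<Sum>i<k. \<Sum>c<n. \<Sum>j<k. \<Sum>d<n. cnj (w i c) * A i j c d * w j d)"
    by (simp add: sum_Times)
  also have "\<dots> = block_form k n A w"
    unfolding block_form_def by (intro sum.cong refl sum.swap)
  finally show ?thesis .
qed

lemma psd_form_pairs:
  "psd_form ({..<k}\<times>{..<n}) (\<lambda>x y. A (fst x) (fst y) (snd x) (snd y))
    \<longleftrightarrow> (\<forall>w. 0 \<le> block_form k n A w)"
proof
  assume L: "psd_form ({..<k}\<times>{..<n}) (\<lambda>x y. A (fst x) (fst y) (snd x) (snd y))"
  show "\<forall>w. 0 \<le> block_form k n A w"
  proof
    fix w
    show "0 \<le> block_form k n A w"
      using L[unfolded psd_form_def, rule_format, of "\<lambda>x. w (fst x) (snd x)"]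
      by (simp only: block_form_pairs)
  qed
next
  assume R: "\<forall>w. 0 \<le> block_form k n A w"
  show "psd_form ({..<k}\<times>{..<n}) (\<lambda>x y. A (fst x) (fst y) (snd x) (snd y))"
    unfolding psd_form_def
  proof
    fix w :: "nat \<times> nat \<Rightarrow> complex"
    show "0 \<le> (\<Sum>x\<in>{..<k}\<times>{..<n}. \<Sum>y\<in>{..<k}\<times>{..<n}.
        cnj (w x) * A (fst x) (fst y) (snd x) (snd y) * w y)"
      using R[rule_format, of "\<lambda>i c. w (i, c)"] block_form_pairs[where w = "\<lambda>i c. w (i, c)"]
      by simp
  qed
qed

text \<open>Over pairs (block, coordinate) the block form is an ordinary quadratic form, evaluated
  at the concatenation of the \<open>b i\<close>.\<close>

lemma block_form_le_trace:
  assumes "\<And>w. 0 \<le> block_form k n A w"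
  shows "block_form k n A b \<le> of_real (\<Sum>i<k. norm_sq n (b i)) * (\<Sum>i<k. \<Sum>c<n. A i i c c)"
    and "0 \<le> (\<Sum>i<k. \<Sum>c<n. A i i c c)"
proof -
  let ?I = "{..<k}\<times>{..<n}"
  have psd: "psd_form ?I (\<lambda>x y. A (fst x) (fst y) (snd x) (snd y))"
    using assms psd_form_pairs by blast
  have tr: "(\<Sum>x\<in>?I. A (fst x) (fst x) (snd x) (snd x)) = (\<Sum>i<k. \<Sum>c<n. A i i c c)"
    by (simp add: sum_Times)
  have nb: "(\<Sum>x\<in>?I. (cmod (b (fst x) (snd x)))\<^sup>2) = (\<Sum>i<k. norm_sq n (b i))"
    by (simp add: sum_Times norm_sq_def)
  show "block_form k n A b \<le> of_real (\<Sum>i<k. norm_sq n (b i)) * (\<Sum>i<k. \<Sum>c<n. A i i c c)"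
    using psd_form_le_trace[OF _ psd, of "\<lambda>x. b (fst x) (snd x)"]
    by (simp only: block_form_pairs tr nb) simp
  show "0 \<le> (\<Sum>i<k. \<Sum>c<n. A i i c c)"
    unfolding tr[symmetric] using psd_form_diag[OF _ psd] by (intro sum_nonneg) auto
qed

text \<open>For fixed coordinates c and d this is a congruence by \<open>C\<close> in the block
  indices. Read from right to left it shows that the transformed family inherits positivity.\<close>

lemma block_form_transform:
  "block_form k n A (\<lambda>i c. \<Sum>p<l. C i p * w p c)
    = block_form l n (\<lambda>p q c d. \<Sum>i<k. \<Sum>j<k. cnj (C i p) * A i j c d * C j q) w"
proof -
  have "block_form k n A (\<lambda>i c. \<Sum>p<l. C i p * w p c)
      = (\<Sum>c<n. \<Sum>d<n. \<Sum>i<k. \<Sum>j<k.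
          cnj (\<Sum>p<l. C i p * w p c) * A i j c d * (\<Sum>q<l. C j q * w q d))"
    unfolding block_form_def by (rule sum_swap_pairs)
  also have "\<dots> = (\<Sum>c<n. \<Sum>d<n. \<Sum>p<l. \<Sum>q<l.
      cnj (w p c) * (\<Sum>i<k. \<Sum>j<k. cnj (C i p) * A i j c d * C j q) * w q d)"
    using sandwich_form[where B = "\<lambda>p i. cnj (C i p)" and S = "{..<l}" and T = "{..<k}"]
    by simp
  also have "\<dots> = block_form l n (\<lambda>p q c d. \<Sum>i<k. \<Sum>j<k. cnj (C i p) * A i j c d * C j q) w"
    unfolding block_form_def by (rule sum_swap_pairs)
  finally show ?thesis .
qed

section \<open>Singular values and the map\<close>

lemma mat_adjoint_dim [simp]:
  "dim_row (mat_adjoint B) = dim_col B" "dim_col (mat_adjoint B) = dim_row B"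
  unfolding mat_adjoint_def by simp_all

lemma mat_adjoint_carrier: "B \<in> carrier_mat m n \<Longrightarrow> mat_adjoint B \<in> carrier_mat n m"
  by (intro carrier_matI) auto

lemma mat_adjoint_index:
  assumes "B \<in> carrier_mat m n" "i < n" "j < m"
  shows "mat_adjoint B $$ (i, j) = cnj (B $$ (j, i))"
  using assms by (auto simp: mat_adjoint_def mat_of_rows_index)

definition mat_apply :: "nat \<Rightarrow> complex mat \<Rightarrow> (nat \<Rightarrow> complex) \<Rightarrow> nat \<Rightarrow> complex" where
  "mat_apply n B x a = (\<Sum>c<n. B $$ (a, c) * x c)"

definition adjoint_apply :: "nat \<Rightarrow> complex mat \<Rightarrow> (nat \<Rightarrow> complex) \<Rightarrow> nat \<Rightarrow> complex" where
  "adjoint_apply m B x c = (\<Sum>a<m. cnj (B $$ (a, c)) * x a)"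

lemma inprod_adjoint_apply: "inprod n (adjoint_apply m B x) y = inprod m x (mat_apply n B y)"
proof -
  have "inprod n (adjoint_apply m B x) y = (\<Sum>c<n. \<Sum>a<m. x a * (cnj (B $$ (a, c)) * cnj (y c)))"
    unfolding inprod_def adjoint_apply_def sum_distrib_right
    by (intro sum.cong refl) (simp add: mult_ac)
  also have "\<dots> = (\<Sum>a<m. \<Sum>c<n. x a * (cnj (B $$ (a, c)) * cnj (y c)))"
    by (rule sum.swap)
  finally show ?thesis by (simp add: inprod_def mat_apply_def sum_distrib_left)
qed

lemma adjoint_apply_scale: "adjoint_apply m B (\<lambda>a. s * x a) c = s * adjoint_apply m B x c"
  by (simp add: adjoint_apply_def sum_distrib_left mult_ac)

lemma adjoint_apply_sum:
  "adjoint_apply m B (\<lambda>a. \<Sum>p\<in>S. s p * e p a) c = (\<Sum>p\<in>S. s p * adjoint_apply m B (e p) c)"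
  unfolding adjoint_apply_def sum_distrib_left
  by (subst sum.swap) (intro sum.cong refl, simp add: mult_ac)

lemma adjoint_apply_cong:
  "(\<And>a. a < m \<Longrightarrow> x a = y a) \<Longrightarrow> adjoint_apply m B x c = adjoint_apply m B y c"
  by (simp add: adjoint_apply_def)

text \<open>The square root is monotone, so sorting the eigenvalues by real part also sorts their
  roots. Thus positions in the list of singular values correspond to positions in a list of
  eigenvalues.\<close>

lemma singular_values_eq_map:
  assumes "char_poly (mat_adjoint B * B) = (\<Prod>e\<leftarrow>es. [:- e, 1:])"
  shows "singular_values B = map (\<lambda>z. sqrt (Re z)) (rev (sort_key Re es))"
proof -
  let ?f = "\<lambda>z. sqrt (Re z)"
  have "proots (\<Prod>e\<leftarrow>es. [:- e, 1:]) = mset es"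
  proof (induct es)
    case (Cons e es)
    have "(\<Prod>e\<leftarrow>es. [:- e, 1:]) \<noteq> 0"
      by (auto simp: prod_list_zero_iff)
    with Cons show ?case
      by (simp add: proots_mult del: mult_pCons_left)
  qed simp
  then have "image_mset ?f (proots (char_poly (mat_adjoint B * B))) = mset (map ?f (sort_key Re es))"
    by (simp add: assms)
  moreover have "sorted (map ?f (sort_key Re es))"
    using sorted_sort_key[of Re es] by (simp add: sorted_wrt_map)
  ultimately show ?thesis
    unfolding singular_values_def
    by (simp only: sorted_list_of_multiset_mset sorted_sort_id rev_map)
qed

text \<open>\<open>lam\<close> lists the eigenvalues of B^* B in decreasing order and continues with
  0, so later sums over \<open>j < k\<close> need no comparison of \<open>k\<close> with
  \<open>n\<close>. The index shift arises because singular values are counted from 1.\<close>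

lemma singular_value_eigenbasis:
  assumes B: "B \<in> carrier_mat m n"
  obtains lam u where "antimono lam" "\<And>j. 0 \<le> lam j" "\<And>j. n \<le> j \<Longrightarrow> lam j = 0"
    "orthonormal_basis n u"
    "\<And>j c. j < n \<Longrightarrow> c < n \<Longrightarrow>
       adjoint_apply m B (mat_apply n B (u j)) c = of_real (lam j) * u j c"
    "\<And>j. j < min m n \<Longrightarrow> (singular_value B (Suc j))\<^sup>2 = lam j"
proof -
  let ?M = "mat_adjoint B * B"
  have M: "?M \<in> carrier_mat n n"
    using B mat_adjoint_carrier[OF B] by simp
  have M_index: "?M $$ (c, d) = (\<Sum>a<m. cnj (B $$ (a, c)) * B $$ (a, d))" if "c < n" "d < n" for c d
    unfolding index_mult_mat_sum[OF mat_adjoint_carrier[OF B] B that]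
    using that by (simp add: mat_adjoint_index[OF B])
  obtain as where as: "char_poly ?M = (\<Prod>e\<leftarrow>as. [:- e, 1:])" and len: "length as = n"
    using char_poly_factorized[OF M] by blast
  \<comment> \<open>The spectral theorem respects whatever order the list of eigenvalues has, so the
    decreasing order is fixed before it is applied.\<close>
  define es where "es = rev (sort_key Re as)"
  have "(\<Prod>e\<leftarrow>es. [:- e, 1:]) = (\<Prod>e\<leftarrow>as. [:- e, 1:])"
    by (simp add: es_def flip: prod_mset_prod_list)
  with as have cp: "char_poly ?M = (\<Prod>e\<leftarrow>es. [:- e, 1:])" by simp
  obtain u where u: "orthonormal_basis n u"
    and eig: "\<And>j c. j < n \<Longrightarrow> c < n \<Longrightarrow> (\<Sum>d<n. ?M $$ (c, d) * u j d) = es ! j * u j c"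
    using hermitian_eigenbasis[OF M _ cp] by (auto simp: M_index mult.commute)
  have BBu: "adjoint_apply m B (mat_apply n B (u j)) c = es ! j * u j c" if "j < n" "c < n" for j c
  proof -
    have "adjoint_apply m B (mat_apply n B (u j)) c
        = (\<Sum>a<m. \<Sum>d<n. cnj (B $$ (a, c)) * B $$ (a, d) * u j d)"
      by (simp add: adjoint_apply_def mat_apply_def sum_distrib_left mult_ac)
    also have "\<dots> = (\<Sum>d<n. (\<Sum>a<m. cnj (B $$ (a, c)) * B $$ (a, d)) * u j d)"
      unfolding sum_distrib_right by (rule sum.swap)
    also have "\<dots> = es ! j * u j c"
      using that by (simp add: M_index flip: eig)
    finally show ?thesis .
  qed
  \<comment> \<open>Taking the squared norm of B u_j makes nonnegativity immediate; pairing B^* B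
    u_j with u_j then identifies it with the eigenvalue and shows the latter to be real.\<close>
  define lam where "lam = (\<lambda>j. if j < n then norm_sq m (mat_apply n B (u j)) else 0)"
  have es_lam: "es ! j = of_real (lam j)" if "j < n" for j
  proof -
    have "of_real (lam j) = inprod n (adjoint_apply m B (mat_apply n B (u j))) (u j)"
      using that by (simp add: lam_def inprod_self inprod_adjoint_apply)
    also have "\<dots> = inprod n (\<lambda>c. es ! j * u j c) (u j)"
      using that BBu by (intro inprod_cong) auto
    also have "\<dots> = es ! j"
      using u that by (simp add: inprod_scale_left orthonormal_basis_def)
    finally show ?thesis by simp
  qed
  have lam_nonneg: "0 \<le> lam j" for j
    by (simp add: lam_def norm_sq_nonneg)
  have "lam j \<le> lam i" if "i \<le> j" for i j
  proof (cases "j < n")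
    case True
    have "sorted (map Re (sort_key Re as))" by simp
    then have "Re (es ! j) \<le> Re (es ! i)"
      using True that len by (simp add: es_def rev_nth sorted_iff_nth_mono)
    then show ?thesis using True that es_lam by simp
  next
    case False
    then show ?thesis using lam_nonneg[of i] by (simp add: lam_def)
  qed
  then have anti: "antimono lam" by (simp add: antimonoI)
  have sv: "(singular_value B (Suc j))\<^sup>2 = lam j" if "j < min m n" for j
    using that B len lam_nonneg[of j] es_lam[of j]
    by (simp add: singular_value_def singular_values_eq_map[OF as] flip: es_def)
       (simp add: es_def)
  show thesis
  proof (rule that[OF anti lam_nonneg _ u _ sv])
    show "lam j = 0" if "n \<le> j" for j using that by (simp add: lam_def)
  qed (auto simp: BBu es_lam)
qed

section \<open>Flattened block matrices as forms over pairs (block, coordinate)\<close>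

lemma bij_betw_block_index:
  "bij_betw (\<lambda>(i, c). i * n + c) ({..<k} \<times> {..<n}) {..<k * n :: nat}"
proof (rule bij_betw_byWitness[where f' = "\<lambda>r. (r div n, r mod n)"])
  show "(\<lambda>(i, c). i * n + c) ` ({..<k} \<times> {..<n}) \<subseteq> {..<k * n}"
  proof clarsimp
    fix i c assume "i < k" "c < n"
    then have "i * n + c < Suc i * n" "Suc i * n \<le> k * n"
      by (simp, intro mult_le_mono1, simp)
    then show "i * n + c < k * n" by linarith
  qed
  show "(\<lambda>r. (r div n, r mod n)) ` {..<k * n} \<subseteq> {..<k} \<times> {..<n}"
    by (auto simp: less_mult_imp_div_less)
       (metis gr_zeroI mod_less_divisor mult_0_right not_less_zero)
qed auto

lemma sum_block_index:
  fixes f :: "nat \<Rightarrow> complex"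
  shows "(\<Sum>r<k * n. f r) = (\<Sum>i<k. \<Sum>c<n. f (i * n + c))"
  using sum.reindex_bij_betw[OF bij_betw_block_index, of f n k]
  by (simp add: sum_Times case_prod_beta)

lemma mat_quadratic_form:
  fixes M :: "complex mat"
  assumes M: "M \<in> carrier_mat N N" and v: "v \<in> carrier_vec N"
  shows "(M *\<^sub>v v) \<bullet>c v = (\<Sum>r<N. \<Sum>s<N. cnj (v $ r) * M $$ (r, s) * v $ s)"
proof -
  have "(M *\<^sub>v v) \<bullet>c v = (\<Sum>r<N. (\<Sum>s<N. M $$ (r, s) * v $ s) * cnj (v $ r))"
    using M v by (simp add: scalar_prod_def atLeast0LessThan)
  also have "\<dots> = (\<Sum>r<N. \<Sum>s<N. cnj (v $ r) * M $$ (r, s) * v $ s)"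
    unfolding sum_distrib_right by (intro sum.cong refl) simp
  finally show ?thesis .
qed

text \<open>Both the Hermitian condition and the quadratic form are carried along the bijection
  between pairs and flattened indices. From here on no index arithmetic with div and mod
  occurs.\<close>

lemma pos_semidef_block_mat:
  "pos_semidef (block_mat k n A) \<longleftrightarrow>
     (\<forall>i<k. \<forall>j<k. \<forall>c<n. \<forall>d<n. A j i $$ (d, c) = cnj (A i j $$ (c, d))) \<and>
     (\<forall>w. 0 \<le> block_form k n (\<lambda>i j c d. A i j $$ (c, d)) w)"
proof -
  let ?M = "block_mat k n A"
  have M: "?M \<in> carrier_mat (k * n) (k * n)" by (simp add: block_mat_def)
  have lt: "i * n + c < k * n" if "i < k" "c < n" for i c
    using bij_betwE[OF bij_betw_block_index[of n k]] that by force
  have M_index: "?M $$ (i * n + c, j * n + d) = A i j $$ (c, d)"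
    if "i < k" "j < k" "c < n" "d < n" for i j c d
    using that lt by (simp add: block_mat_def)
  have "mat_adjoint ?M = ?M \<longleftrightarrow> (\<forall>r<k * n. \<forall>s<k * n. ?M $$ (r, s) = cnj (?M $$ (s, r)))"
    (is "_ \<longleftrightarrow> ?H")
  proof
    assume eq: "mat_adjoint ?M = ?M"
    show ?H using mat_adjoint_index[OF M] by (metis eq)
  next
    assume H: ?H
    show "mat_adjoint ?M = ?M"
    proof (rule eq_matI)
      fix r s assume "r < dim_row ?M" "s < dim_col ?M"
      then have rs: "r < k * n" "s < k * n" using carrier_matD[OF M] by auto
      show "mat_adjoint ?M $$ (r, s) = ?M $$ (r, s)"
        unfolding mat_adjoint_index[OF M rs] using H rs by metis
    qed (simp_all add: block_mat_def)
  qed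
  also have "?H \<longleftrightarrow> (\<forall>x\<in>{..<k} \<times> {..<n}. \<forall>y\<in>{..<k} \<times> {..<n}.
      ?M $$ (fst x * n + snd x, fst y * n + snd y) = cnj (?M $$ (fst y * n + snd y, fst x * n + snd x)))"
  proof -
    have img: "{..<k * n} = (\<lambda>x. fst x * n + snd x) ` ({..<k} \<times> {..<n})"
      using bij_betw_imp_surj_on[OF bij_betw_block_index[of n k]] by (simp add: case_prod_beta)
    have "?H \<longleftrightarrow> (\<forall>r\<in>{..<k * n}. \<forall>s\<in>{..<k * n}. ?M $$ (r, s) = cnj (?M $$ (s, r)))"
      by auto
    then show ?thesis unfolding img by simp
  qed
  also have "\<dots> \<longleftrightarrow> (\<forall>i<k. \<forall>j<k. \<forall>c<n. \<forall>d<n. A j i $$ (d, c) = cnj (A i j $$ (c, d)))"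
    by (auto simp: M_index)
  finally have herm: "mat_adjoint ?M = ?M \<longleftrightarrow>
    (\<forall>i<k. \<forall>j<k. \<forall>c<n. \<forall>d<n. A j i $$ (d, c) = cnj (A i j $$ (c, d)))" .
  have form: "(?M *\<^sub>v v) \<bullet>c v
      = block_form k n (\<lambda>i j c d. A i j $$ (c, d)) (\<lambda>i c. v $ (i * n + c))"
    if v: "v \<in> carrier_vec (k * n)" for v :: "complex vec"
  proof -
    have "(?M *\<^sub>v v) \<bullet>c v = (\<Sum>r<k * n. \<Sum>s<k * n. cnj (v $ r) * ?M $$ (r, s) * v $ s)"
      by (rule mat_quadratic_form[OF M v])
    also have "\<dots> = (\<Sum>i<k. \<Sum>c<n. \<Sum>j<k. \<Sum>d<n.
        cnj (v $ (i * n + c)) * ?M $$ (i * n + c, j * n + d) * v $ (j * n + d))"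
      by (simp add: sum_block_index)
    also have "\<dots> = (\<Sum>i<k. \<Sum>j<k. \<Sum>c<n. \<Sum>d<n.
        cnj (v $ (i * n + c)) * ?M $$ (i * n + c, j * n + d) * v $ (j * n + d))"
      by (intro sum.cong refl sum.swap)
    also have "\<dots> = block_form k n (\<lambda>i j c d. A i j $$ (c, d)) (\<lambda>i c. v $ (i * n + c))"
      unfolding block_form_def by (intro sum.cong refl) (simp add: M_index)
    finally show ?thesis .
  qed
  have "(\<forall>v\<in>carrier_vec (k * n). 0 \<le> (?M *\<^sub>v v) \<bullet>c v)
      \<longleftrightarrow> (\<forall>w. 0 \<le> block_form k n (\<lambda>i j c d. A i j $$ (c, d)) w)"
  proof (intro iffI allI ballI)
    fix w :: "nat \<Rightarrow> nat \<Rightarrow> complex"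
    assume L: "\<forall>v\<in>carrier_vec (k * n). 0 \<le> (?M *\<^sub>v v) \<bullet>c v"
    define v where "v = vec (k * n) (\<lambda>r. w (r div n) (r mod n))"
    have v: "v \<in> carrier_vec (k * n)" by (simp add: v_def)
    have "block_form k n (\<lambda>i j c d. A i j $$ (c, d)) (\<lambda>i c. v $ (i * n + c))
        = block_form k n (\<lambda>i j c d. A i j $$ (c, d)) w"
      using lt by (intro block_form_cong) (simp_all add: v_def)
    then show "0 \<le> block_form k n (\<lambda>i j c d. A i j $$ (c, d)) w"
      using L v form[OF v] by metis
  qed (simp add: form)
  then show ?thesis
    using M herm by (auto simp: pos_semidef_def)
qed

section \<open>The map in coordinates and the scalar form of k-positivity\<close>

lemma Phi_minus_dim [simp]:
  "dim_row (Phi_minus \<alpha> B X) = dim_row B" "dim_col (Phi_minus \<alpha> B X) = dim_row B"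
  by (simp_all add: Phi_minus_def)

lemma Phi_minus_index:
  assumes B: "B \<in> carrier_mat m n" and X: "X \<in> carrier_mat n n" and ab: "a < m" "b < m"
  shows "Phi_minus \<alpha> B X $$ (a, b) = of_real \<alpha> * (\<Sum>c<n. X $$ (c, c)) * (if a = b then 1 else 0)
    - (\<Sum>c<n. \<Sum>d<n. B $$ (a, c) * X $$ (c, d) * cnj (B $$ (b, d)))"
proof -
  note B' = mat_adjoint_carrier[OF B]
  have BX: "B * X \<in> carrier_mat m n" using B X by simp
  have "(B * X * mat_adjoint B) $$ (a, b)
      = (\<Sum>d<n. (\<Sum>c<n. B $$ (a, c) * X $$ (c, d)) * cnj (B $$ (b, d)))"
    unfolding index_mult_mat_sum[OF BX B' ab] using ab
    by (intro sum.cong refl)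
       (simp add: index_mult_mat_sum[OF B X] mat_adjoint_index[OF B] del: index_mult_mat)
  also have "\<dots> = (\<Sum>c<n. \<Sum>d<n. B $$ (a, c) * X $$ (c, d) * cnj (B $$ (b, d)))"
    unfolding sum_distrib_right by (rule sum.swap)
  finally show ?thesis
    using B X B' ab by (simp add: Phi_minus_def mat_trace_def del: index_mult_mat(1))
qed

lemma linear_mat_map_Phi_minus:
  assumes B: "B \<in> carrier_mat m n"
  shows "linear_mat_map n m (Phi_minus \<alpha> B)"
  unfolding linear_mat_map_def
proof (intro conjI ballI allI)
  show "Phi_minus \<alpha> B X \<in> carrier_mat m m" for X
    using B by (intro carrier_matI) auto
next
  fix X Y :: "complex mat" assume X: "X \<in> carrier_mat n n" and Y: "Y \<in> carrier_mat n n"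
  then have XY: "X + Y \<in> carrier_mat n n" by simp
  show "Phi_minus \<alpha> B (X + Y) = Phi_minus \<alpha> B X + Phi_minus \<alpha> B Y"
  proof (rule eq_matI)
    fix a b assume "a < dim_row (Phi_minus \<alpha> B X + Phi_minus \<alpha> B Y)"
      "b < dim_col (Phi_minus \<alpha> B X + Phi_minus \<alpha> B Y)"
    then have ab: "a < m" "b < m" using B by auto
    have ix: "(X + Y) $$ (c, d) = X $$ (c, d) + Y $$ (c, d)" if "c < n" "d < n" for c d
      using X Y that by simp
    have sum_ab: "(Phi_minus \<alpha> B X + Phi_minus \<alpha> B Y) $$ (a, b)
        = Phi_minus \<alpha> B X $$ (a, b) + Phi_minus \<alpha> B Y $$ (a, b)"
      using ab B by simp
    show "Phi_minus \<alpha> B (X + Y) $$ (a, b) = (Phi_minus \<alpha> B X + Phi_minus \<alpha> B Y) $$ (a, b)"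
      unfolding sum_ab Phi_minus_index[OF B X ab] Phi_minus_index[OF B Y ab]
        Phi_minus_index[OF B XY ab]
      by (simp add: ix sum.distrib algebra_simps)
  qed auto
next
  fix s and X :: "complex mat" assume X: "X \<in> carrier_mat n n"
  then have sX: "s \<cdot>\<^sub>m X \<in> carrier_mat n n" by simp
  show "Phi_minus \<alpha> B (s \<cdot>\<^sub>m X) = s \<cdot>\<^sub>m Phi_minus \<alpha> B X"
  proof (rule eq_matI)
    fix a b assume "a < dim_row (s \<cdot>\<^sub>m Phi_minus \<alpha> B X)" "b < dim_col (s \<cdot>\<^sub>m Phi_minus \<alpha> B X)"
    then have ab: "a < m" "b < m" using B by auto
    have ix: "(s \<cdot>\<^sub>m X) $$ (c, d) = s * X $$ (c, d)" if "c < n" "d < n" for c d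
      using X that by simp
    have smult_ab: "(s \<cdot>\<^sub>m Phi_minus \<alpha> B X) $$ (a, b) = s * Phi_minus \<alpha> B X $$ (a, b)"
      using ab B by simp
    show "Phi_minus \<alpha> B (s \<cdot>\<^sub>m X) $$ (a, b) = (s \<cdot>\<^sub>m Phi_minus \<alpha> B X) $$ (a, b)"
      unfolding smult_ab Phi_minus_index[OF B X ab] Phi_minus_index[OF B sX ab]
      by (simp add: ix sum_distrib_left algebra_simps)
  qed auto
qed

text \<open>The identity matrix leaves v_i^* v_j as weight of the trace of block (i, j), while
  \<open>sandwich_form\<close> shifts \<open>B\<close> from the block to the test vectors.\<close>

lemma block_form_Phi_minus:
  "block_form k m (\<lambda>i j a b. of_real \<alpha> * (\<Sum>c<n. A i j c c) * (if a = b then 1 else 0)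
      - (\<Sum>c<n. \<Sum>d<n. B $$ (a, c) * A i j c d * cnj (B $$ (b, d)))) v
   = of_real \<alpha> * (\<Sum>i<k. \<Sum>j<k. (\<Sum>c<n. A i j c c) * inprod m (v j) (v i))
     - block_form k n A (\<lambda>i. adjoint_apply m B (v i))"
proof -
  have inner: "(\<Sum>a<m. \<Sum>b<m. cnj (x a) * (\<alpha>' * \<tau> * (if a = b then 1 else 0)
        - (\<Sum>c<n. \<Sum>d<n. B $$ (a, c) * X c d * cnj (B $$ (b, d)))) * y b)
      = \<alpha>' * (\<tau> * inprod m y x)
        - (\<Sum>c<n. \<Sum>d<n. cnj (adjoint_apply m B x c) * X c d * adjoint_apply m B y d)"
    for x y :: "nat \<Rightarrow> complex" and X and \<tau> \<alpha>' :: complex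
  proof -
    have "(\<Sum>a<m. \<Sum>b<m. cnj (x a) * (\<alpha>' * \<tau> * (if a = b then 1 else 0)
        - (\<Sum>c<n. \<Sum>d<n. B $$ (a, c) * X c d * cnj (B $$ (b, d)))) * y b)
      = (\<Sum>a<m. \<Sum>b<m. if a = b then \<alpha>' * \<tau> * (y a * cnj (x a)) else 0)
        - (\<Sum>a<m. \<Sum>b<m. cnj (x a)
            * (\<Sum>c<n. \<Sum>d<n. B $$ (a, c) * X c d * cnj (B $$ (b, d))) * y b)"
      unfolding sum_subtractf[symmetric]
      by (intro sum.cong refl) (simp add: algebra_simps)
    also have "(\<Sum>a<m. \<Sum>b<m. if a = b then \<alpha>' * \<tau> * (y a * cnj (x a)) else 0)
        = \<alpha>' * (\<tau> * inprod m y x)"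
      by (simp add: inprod_def sum_distrib_left mult.assoc)
    finally show ?thesis
      unfolding sandwich_form adjoint_apply_def .
  qed
  show ?thesis
    unfolding block_form_def inner by (simp add: sum_subtractf sum_distrib_left)
qed

text \<open>The map is linear and sends Hermitian block matrices to Hermitian ones, so the only
  condition with content is the sign of the form, already expanded here.\<close>

lemma k_positive_Phi_minus_iff:
  assumes B: "B \<in> carrier_mat m n"
  shows "k_positive n m k (Phi_minus \<alpha> B) \<longleftrightarrow>
    (\<forall>A. (\<forall>i<k. \<forall>j<k. \<forall>c<n. \<forall>d<n. A j i d c = cnj (A i j c d)) \<and>
         (\<forall>w. 0 \<le> block_form k n A w) \<longrightarrow>
       (\<forall>v. 0 \<le> of_real \<alpha> * (\<Sum>i<k. \<Sum>j<k. (\<Sum>c<n. A i j c c) * inprod m (v j) (v i))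
          - block_form k n A (\<lambda>i. adjoint_apply m B (v i))))"
    (is "?L \<longleftrightarrow> ?R")
proof
  have form: "block_form k m (\<lambda>i j a b. Phi_minus \<alpha> B (A i j) $$ (a, b)) v
      = of_real \<alpha> * (\<Sum>i<k. \<Sum>j<k. (\<Sum>c<n. A i j $$ (c, c)) * inprod m (v j) (v i))
          - block_form k n (\<lambda>i j c d. A i j $$ (c, d)) (\<lambda>i. adjoint_apply m B (v i))"
    if "\<forall>i<k. \<forall>j<k. A i j \<in> carrier_mat n n" for A v
    unfolding block_form_Phi_minus[where A = "\<lambda>i j c d. A i j $$ (c, d)", symmetric] using that
    by (intro block_form_cong) (simp_all add: Phi_minus_index[OF B])
  {
    assume L: ?L
    show ?R
    proof (intro allI impI, elim conjE)
      fix A v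
      assume herm: "\<forall>i<k. \<forall>j<k. \<forall>c<n. \<forall>d<n. A j i d c = cnj (A i j c d)"
        and psd: "\<forall>w. 0 \<le> block_form k n A w"
      define A' where "A' = (\<lambda>i j. mat n n (\<lambda>(c, d). A i j c d))"
      have A'_index: "A' i j $$ (c, d) = A i j c d" if "c < n" "d < n" for i j c d
        using that by (simp add: A'_def)
      have A': "\<forall>i<k. \<forall>j<k. A' i j \<in> carrier_mat n n" by (simp add: A'_def)
      have bf: "block_form k n (\<lambda>i j c d. A' i j $$ (c, d)) w = block_form k n A w" for w
        by (intro block_form_cong) (simp_all add: A'_index)
      have "pos_semidef (block_mat k n A')"
        unfolding pos_semidef_block_mat bf using psd
      proof (intro conjI allI impI)
        fix i j c d assume "i < k" "j < k" "c < n" "d < n"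
        then show "A' j i $$ (d, c) = cnj (A' i j $$ (c, d))"
          unfolding A'_index[OF \<open>c < n\<close> \<open>d < n\<close>] A'_index[OF \<open>d < n\<close> \<open>c < n\<close>]
          using herm by metis
      qed simp
      then have "pos_semidef (block_mat k m (\<lambda>i j. Phi_minus \<alpha> B (A' i j)))"
        using L A' unfolding k_positive_def by blast
      then have "0 \<le> block_form k m (\<lambda>i j a b. Phi_minus \<alpha> B (A' i j) $$ (a, b)) v"
        unfolding pos_semidef_block_mat by blast
      then show "0 \<le> of_real \<alpha> * (\<Sum>i<k. \<Sum>j<k. (\<Sum>c<n. A i j c c) * inprod m (v j) (v i))
          - block_form k n A (\<lambda>i. adjoint_apply m B (v i))"
        unfolding form[OF A'] bf by (simp add: A'_index)
    qed
  next
    assume R: ?R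
    show ?L
      unfolding k_positive_def
    proof (intro conjI allI impI, rule linear_mat_map_Phi_minus[OF B], elim conjE)
      fix A assume A: "\<forall>i<k. \<forall>j<k. A i j \<in> carrier_mat n n"
        and "pos_semidef (block_mat k n A)"
      then have herm: "\<forall>i<k. \<forall>j<k. \<forall>c<n. \<forall>d<n. A j i $$ (d, c) = cnj (A i j $$ (c, d))"
        and psd: "\<forall>w. 0 \<le> block_form k n (\<lambda>i j c d. A i j $$ (c, d)) w"
        unfolding pos_semidef_block_mat by blast+
      show "pos_semidef (block_mat k m (\<lambda>i j. Phi_minus \<alpha> B (A i j)))"
        unfolding pos_semidef_block_mat
      proof (intro conjI allI impI)
        fix v
        show "0 \<le> block_form k m (\<lambda>i j a b. Phi_minus \<alpha> B (A i j) $$ (a, b)) v"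
          unfolding form[OF A]
          using R[rule_format, of "\<lambda>i j c d. A i j $$ (c, d)" v] herm psd by blast
      next
        fix i j a b assume ij: "i < k" "j < k" and ab: "a < m" "b < m"
        have Aij: "A i j \<in> carrier_mat n n" "A j i \<in> carrier_mat n n" using A ij by auto
        have h: "cnj (A i j $$ (c, d)) = A j i $$ (d, c)" if "c < n" "d < n" for c d
          using herm ij that by metis
        have "(\<Sum>c<n. \<Sum>d<n. B $$ (b, c) * A j i $$ (c, d) * cnj (B $$ (a, d)))
            = (\<Sum>d<n. \<Sum>c<n. B $$ (b, c) * A j i $$ (c, d) * cnj (B $$ (a, d)))"
          by (rule sum.swap)
        also have "\<dots> = (\<Sum>c<n. \<Sum>d<n. cnj (B $$ (a, c) * A i j $$ (c, d) * cnj (B $$ (b, d))))"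
          by (intro sum.cong refl) (simp add: h)
        finally show "Phi_minus \<alpha> B (A j i) $$ (b, a) = cnj (Phi_minus \<alpha> B (A i j) $$ (a, b))"
          unfolding Phi_minus_index[OF B Aij(1) ab] Phi_minus_index[OF B Aij(2) ab(2,1)]
          by (simp add: h)
      qed
    qed
  }
qed

text \<open>The test matrix is w w^* for the concatenation of the \<open>w i\<close>; its form is a
  squared modulus, hence nonnegative. \<open>w\<close> and \<open>v\<close> stay independent so that
  singular vectors and plain unit vectors can both be inserted.\<close>

lemma k_positive_Phi_minus_rank_one:
  assumes B: "B \<in> carrier_mat m n" and kpos: "k_positive n m k (Phi_minus \<alpha> B)"
  shows "(cmod (\<Sum>i<k. inprod n (w i) (adjoint_apply m B (v i))))\<^sup>2
    \<le> \<alpha> * Re (\<Sum>i<k. \<Sum>j<k. inprod n (w i) (w j) * inprod m (v j) (v i))"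
proof -
  define A where "A = (\<lambda>i j c d. w i c * cnj (w j d))"
  have form: "block_form k n A x = of_real ((cmod (\<Sum>i<k. inprod n (w i) (x i)))\<^sup>2)" for x
  proof -
    define s where "s = (\<Sum>i<k. inprod n (w i) (x i))"
    have "block_form k n A x = (\<Sum>i<k. \<Sum>j<k. inprod n (w i) (x i) * cnj (inprod n (w j) (x j)))"
      unfolding block_form_def
      by (intro sum.cong refl) (simp add: A_def inprod_def sum_product mult_ac)
    also have "\<dots> = s * cnj s"
      by (simp add: s_def sum_product)
    finally show ?thesis by (simp add: s_def complex_norm_square del: of_real_power)
  qed
  have "0 \<le> of_real \<alpha> * (\<Sum>i<k. \<Sum>j<k. (\<Sum>c<n. A i j c c) * inprod m (v j) (v i))
          - block_form k n A (\<lambda>i. adjoint_apply m B (v i))"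
  proof -
    have herm: "\<forall>i<k. \<forall>j<k. \<forall>c<n. \<forall>d<n. A j i d c = cnj (A i j c d)"
      by (simp add: A_def mult.commute)
    have psd: "\<forall>w. 0 \<le> block_form k n A w"
      by (simp add: form less_eq_complex_def del: of_real_power)
    show ?thesis
      by (rule kpos[unfolded k_positive_Phi_minus_iff[OF B], rule_format, of A, OF conjI[OF herm psd]])
  qed
  then show ?thesis
    unfolding form by (simp add: less_eq_complex_def A_def inprod_def del: of_real_power)
qed

lemma orthonormal_or_zero_norm_le:
  "orthonormal_or_zero n k e \<Longrightarrow> p < k \<Longrightarrow> norm_sq n (e p) \<le> 1"
  by (force simp: orthonormal_or_zero_def)

section \<open>Singular vectors and Ky Fan's principle\<close>

text \<open>\<open>lam j\<close> plays the role of the squared singular value number j + 1, and the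
  \<open>u j\<close> are the right singular vectors.\<close>

locale svd =
  fixes m n :: nat and B :: "complex mat" and lam :: "nat \<Rightarrow> real" and u :: "nat \<Rightarrow> nat \<Rightarrow> complex"
  assumes anti: "antimono lam" and lam_nonneg: "0 \<le> lam j" and lam_zero: "n \<le> j \<Longrightarrow> lam j = 0"
    and basis: "orthonormal_basis n u"
    and eigen: "j < n \<Longrightarrow> c < n \<Longrightarrow>
      adjoint_apply m B (mat_apply n B (u j)) c = of_real (lam j) * u j c"
begin

text \<open>Left singular vectors; the division by 0 makes those of vanishing singular value 0.\<close>

definition left_sv :: "nat \<Rightarrow> nat \<Rightarrow> complex" where
  "left_sv j a = of_real (1 / sqrt (lam j)) * mat_apply n B (u j) a"

lemma inprod_images:
  assumes "i < n" "j < n"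
  shows "inprod m (mat_apply n B (u i)) (mat_apply n B (u j)) = (if i = j then of_real (lam i) else 0)"
proof -
  have "inprod m (mat_apply n B (u i)) (mat_apply n B (u j))
      = inprod n (adjoint_apply m B (mat_apply n B (u i))) (u j)"
    by (simp add: inprod_adjoint_apply)
  also have "\<dots> = inprod n (\<lambda>c. of_real (lam i) * u i c) (u j)"
    using assms eigen by (intro inprod_cong) auto
  finally show ?thesis using basis assms by (simp add: inprod_scale_left orthonormal_basis_def)
qed

lemma inprod_left_sv: "inprod m (left_sv i) (left_sv j) = (if i = j \<and> lam i \<noteq> 0 then 1 else 0)"
proof (cases "i < n \<and> j < n")
  case True
  have "inprod m (left_sv i) (left_sv j) = of_real (1 / sqrt (lam i)) * (of_real (1 / sqrt (lam j)) *
      inprod m (mat_apply n B (u i)) (mat_apply n B (u j)))"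
    unfolding left_sv_def by (simp only: inprod_scale_left inprod_scale_right complex_cnj_complex_of_real)
  then show ?thesis
    using True lam_nonneg[of j] by (auto simp: inprod_images simp flip: of_real_mult)
next
  case False
  then have "left_sv i = (\<lambda>_. 0) \<or> left_sv j = (\<lambda>_. 0)" and "\<not> (i = j \<and> lam i \<noteq> 0)"
    using lam_zero[of i] lam_zero[of j] by (auto simp: left_sv_def fun_eq_iff)
  then show ?thesis by (auto simp: inprod_def)
qed

text \<open>The length \<open>l\<close> is free, since members with \<open>lam j = 0\<close> are
  zero vectors; Ky Fan's bound uses length \<open>n\<close> in dimension \<open>m\<close>, even if
  \<open>m < n\<close>.\<close>

lemma orthonormal_or_zero_left_sv: "orthonormal_or_zero m l left_sv"
proof -
  have "norm_sq m (left_sv p) = 0 \<or> norm_sq m (left_sv p) = 1" for p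
    using inprod_left_sv[of p p] by (auto simp: inprod_self split: if_splits)
  then show ?thesis by (simp add: orthonormal_or_zero_def inprod_left_sv)
qed

lemma adjoint_left_sv:
  assumes "c < n"
  shows "adjoint_apply m B (left_sv j) c = of_real (sqrt (lam j)) * u j c"
proof (cases "j < n")
  case True
  have "adjoint_apply m B (left_sv j) c = of_real (1 / sqrt (lam j)) * (of_real (lam j) * u j c)"
    unfolding left_sv_def by (simp only: adjoint_apply_scale eigen[OF True assms])
  also have "\<dots> = of_real (lam j / sqrt (lam j)) * u j c" by simp
  finally show ?thesis using lam_nonneg[of j] by (simp only: real_div_sqrt)
next
  case False
  then show ?thesis using lam_zero[of j] by (simp add: left_sv_def adjoint_apply_def)
qed

text \<open>In essence B u_j is the root of \<open>lam j\<close> times \<open>left_sv j\<close>. If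
  \<open>lam j = 0\<close>, the latter is 0 by convention, and B u_j vanishes because its squared
  norm is \<open>lam j\<close>.\<close>

lemma inprod_image_left_sv:
  assumes "j < n"
  shows "inprod m x (mat_apply n B (u j)) = of_real (sqrt (lam j)) * inprod m x (left_sv j)"
proof (cases "lam j = 0")
  case True
  then have "norm_sq m (mat_apply n B (u j)) = 0"
    using inprod_images[OF assms assms] by (simp add: inprod_self)
  then show ?thesis using True by (simp add: norm_sq_eq_0 inprod_def)
next
  case False
  then have "mat_apply n B (u j) = (\<lambda>a. of_real (sqrt (lam j)) * left_sv j a)"
    by (simp add: left_sv_def fun_eq_iff)
  then show ?thesis by (simp add: inprod_scale_right)
qed

text \<open>Parseval in the eigenbasis turns the left side into the sum of
  \<open>lam j * t j\<close>. Bessel's inequality is used twice: with respect to \<open>e\<close> it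
  bounds each weight by 1, with respect to \<open>left_sv\<close> it bounds the total weight by
  \<open>k\<close>.\<close>

lemma ky_fan:
  assumes e: "orthonormal_or_zero m k e"
  shows "(\<Sum>p<k. norm_sq n (adjoint_apply m B (e p))) \<le> (\<Sum>j<k. lam j)"
proof -
  define t where "t = (\<lambda>j. \<Sum>p<k. (cmod (inprod m (left_sv j) (e p)))\<^sup>2)"
  have abs_comm: "cmod (inprod m x y) = cmod (inprod m y x)" for x y
    using inprod_commute[of m x y] by simp
  have "(\<Sum>p<k. norm_sq n (adjoint_apply m B (e p)))
      = (\<Sum>p<k. \<Sum>j<n. lam j * (cmod (inprod m (left_sv j) (e p)))\<^sup>2)"
    using lam_nonneg
    by (intro sum.cong refl)
       (simp add: parseval[OF basis] inprod_adjoint_apply inprod_image_left_sv norm_mult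
         power_mult_distrib abs_comm[of "e _"])
  also have "\<dots> = (\<Sum>j<n. lam j * t j)"
    unfolding t_def sum_distrib_left by (rule sum.swap)
  also have "\<dots> \<le> (\<Sum>j<k. lam j)"
  proof (rule weighted_sum_le_sum_largest[OF anti lam_nonneg])
    show "0 \<le> t j" for j by (simp add: t_def sum_nonneg)
    show "t j \<le> 1" for j
      using bessel[OF e, of "left_sv j"]
        orthonormal_or_zero_norm_le[OF orthonormal_or_zero_left_sv, of j "Suc j"]
      by (simp add: t_def)
    have "(\<Sum>j<n. t j) = (\<Sum>p<k. \<Sum>j<n. (cmod (inprod m (e p) (left_sv j)))\<^sup>2)"
      unfolding t_def by (subst sum.swap) (simp add: abs_comm)
    also have "\<dots> \<le> (\<Sum>p<k. norm_sq m (e p))"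
      by (intro sum_mono bessel[OF orthonormal_or_zero_left_sv])
    also have "\<dots> \<le> (\<Sum>p<k. 1)"
      by (intro sum_mono orthonormal_or_zero_norm_le[OF e]) simp
    finally show "(\<Sum>j<n. t j) \<le> real k" by simp
  qed
  finally show ?thesis .
qed

section \<open>The two directions of the equivalence\<close>

lemma sum_lam_le_of_k_positive:
  assumes B: "B \<in> carrier_mat m n" and "m \<ge> 1" "n \<ge> 1" "k \<ge> 1"
    and kpos: "k_positive n m k (Phi_minus \<alpha> B)"
  shows "(\<Sum>j<k. lam j) \<le> \<alpha>"
proof -
  define S where "S = (\<Sum>j<k. lam j)"
  define w where "w = (\<lambda>j. adjoint_apply m B (left_sv j))"
  have ww: "inprod n (w i) (w i) = of_real (lam i)" for i
  proof -
    have "inprod n (w i) (w i)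
        = inprod n (\<lambda>c. of_real (sqrt (lam i)) * u i c) (\<lambda>c. of_real (sqrt (lam i)) * u i c)"
      by (intro inprod_cong) (simp_all add: w_def adjoint_left_sv)
    also have "\<dots> = of_real (sqrt (lam i) * sqrt (lam i)) * inprod n (u i) (u i)"
      by (simp only: inprod_scale_left inprod_scale_right complex_cnj_complex_of_real
          of_real_mult mult.assoc)
    also have "\<dots> = of_real (lam i) * inprod n (u i) (u i)"
      using lam_nonneg[of i] by simp
    finally show ?thesis
      using basis lam_zero[of i] by (cases "i < n") (auto simp: orthonormal_basis_def)
  qed
  \<comment> \<open>Orthogonality removes the terms with i and j distinct. Where
    \<open>left_sv i\<close> is zero instead of a unit vector, \<open>lam i\<close> vanishes as
    well, so the sum is unaffected.\<close>
  have "(\<Sum>i<k. \<Sum>j<k. inprod n (w i) (w j) * inprod m (left_sv j) (left_sv i))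
      = (\<Sum>i<k. \<Sum>j<k. if j = i then of_real (lam i) else 0)"
    by (intro sum.cong refl) (simp add: inprod_left_sv ww)
  then have "(\<Sum>i<k. \<Sum>j<k. inprod n (w i) (w j) * inprod m (left_sv j) (left_sv i)) = of_real S"
    by (simp add: S_def)
  moreover have "(\<Sum>i<k. inprod n (w i) (adjoint_apply m B (left_sv i))) = of_real S"
    using ww by (simp add: S_def w_def)
  ultimately have S: "S\<^sup>2 \<le> \<alpha> * S"
    using k_positive_Phi_minus_rank_one[OF B kpos, of w left_sv] by (simp add: norm_of_real)
  have S_nonneg: "0 \<le> S" by (simp add: S_def sum_nonneg lam_nonneg)
  show ?thesis
  proof (cases "S = 0")
    case False
    then show ?thesis using S S_nonneg by (simp add: power2_eq_square flip: S_def)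
  next
    case True
    \<comment> \<open>For \<open>S = 0\<close> the inequality \<open>S\<close> obtained above
      carries no information. Here block 0 is the first unit vector and all other blocks are 0; the
      same family is used in dimension \<open>n\<close> and in dimension \<open>m\<close>.\<close>
    define d where "d = (\<lambda>i c. if i = (0::nat) \<and> c = (0::nat) then 1 else (0::complex))"
    have d0: "inprod l (d i) (d j) = (if i = 0 \<and> j = 0 then 1 else 0)" if "l \<ge> 1" for l i j
    proof -
      have "inprod l (d i) (d j) = (\<Sum>c<l. if c = 0 then if i = 0 \<and> j = 0 then 1 else 0 else 0)"
        unfolding inprod_def by (intro sum.cong refl) (simp add: d_def)
      then show ?thesis using that by simp
    qed
    have "0 \<le> \<alpha> * Re (\<Sum>i<k. \<Sum>j<k. inprod n (d i) (d j) * inprod m (d j) (d i))"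
      using k_positive_Phi_minus_rank_one[OF B kpos, of d d] by (meson order_trans zero_le_power2)
    also have "(\<Sum>i<k. \<Sum>j<k. inprod n (d i) (d j) * inprod m (d j) (d i))
        = (\<Sum>i<k. \<Sum>j<k. if j = 0 then if i = 0 then 1 else 0 else 0)"
      using assms by (intro sum.cong refl) (simp add: d0)
    also have "\<dots> = 1" using assms by simp
    finally show ?thesis using True by (simp flip: S_def)
  qed
qed

lemma k_positive_of_sum_lam_le:
  assumes B: "B \<in> carrier_mat m n" and \<alpha>: "(\<Sum>j<k. lam j) \<le> \<alpha>"
  shows "k_positive n m k (Phi_minus \<alpha> B)"
  unfolding k_positive_Phi_minus_iff[OF B]
proof (intro allI impI, elim conjE)
  fix A v
  assume psd: "\<forall>w. 0 \<le> block_form k n A w"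
  obtain e where e: "orthonormal_or_zero m k e"
    and ve: "\<And>i a. i < k \<Longrightarrow> a < m \<Longrightarrow> v i a = (\<Sum>p\<le>i. inprod m (v i) (e p) * e p a)"
    using gram_schmidt_orthonormal_or_zero[of m k v] by blast
  \<comment> \<open>The triangular coefficients are padded with 0 to a full square array, as the
    congruence sums over all \<open>p < k\<close>.\<close>
  define C where "C = (\<lambda>i p. if p \<le> i then inprod m (v i) (e p) else 0)"
  have vC: "v i a = (\<Sum>p<k. C i p * e p a)" if "i < k" "a < m" for i a
  proof -
    have "v i a = (\<Sum>p\<le>i. C i p * e p a)"
      using ve[OF that] by (simp add: C_def)
    also have "\<dots> = (\<Sum>p<k. C i p * e p a)"
      using that by (intro sum.mono_neutral_left) (auto simp: C_def)
    finally show ?thesis .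
  qed
  define A' where "A' = (\<lambda>p q c d. \<Sum>i<k. \<Sum>j<k. cnj (C i p) * A i j c d * C j q)"
  define b where "b = (\<lambda>p. adjoint_apply m B (e p))"
  define T where "T = (\<Sum>p<k. \<Sum>c<n. A' p p c c)"
  have psd': "0 \<le> block_form k n A' w" for w
    unfolding A'_def block_form_transform[symmetric] using psd by blast
  have "block_form k n A (\<lambda>i. adjoint_apply m B (v i))
      = block_form k n A (\<lambda>i c. \<Sum>p<k. C i p * b p c)"
  proof (rule block_form_cong)
    fix i c assume "i < k"
    then have "adjoint_apply m B (v i) c = adjoint_apply m B (\<lambda>a. \<Sum>p<k. C i p * e p a) c"
      using vC by (intro adjoint_apply_cong) auto
    then show "adjoint_apply m B (v i) c = (\<Sum>p<k. C i p * b p c)"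
      by (simp add: adjoint_apply_sum b_def)
  qed simp
  then have form: "block_form k n A (\<lambda>i. adjoint_apply m B (v i)) = block_form k n A' b"
    by (simp add: block_form_transform A'_def)
  have vv: "inprod m (v j) (v i) = (\<Sum>p<k. cnj (C i p) * C j p)" if "i < k" "j < k" for i j
  proof -
    have "inprod m (v j) (v i)
        = inprod m (\<lambda>a. \<Sum>p<k. C j p * e p a) (\<lambda>a. \<Sum>q<k. C i q * e q a)"
      using that vC by (intro inprod_cong) auto
    also have "\<dots> = (\<Sum>p<k. C j p * (\<Sum>q<k. cnj (C i q) * inprod m (e p) (e q)))"
      by (simp add: inprod_sum_left inprod_sum_right inprod_scale_left inprod_scale_right
          sum_distrib_left)
    also have "\<dots> = (\<Sum>p<k. C j p * (\<Sum>q<k. if q = p then cnj (C i p) * inprod m (e p) (e p) else 0))"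
      using e by (intro sum.cong refl arg_cong2[of _ _ _ _ "(*)"]) (auto simp: orthonormal_or_zero_def)
    also have "\<dots> = (\<Sum>p<k. cnj (C i p) * (C j p * inprod m (e p) (e p)))"
      by (simp add: mult_ac)
    \<comment> \<open>If \<open>e p\<close> is zero, its squared norm is 0 instead of 1, but then
      \<open>C j p\<close> is 0 too.\<close>
    also have "\<dots> = (\<Sum>p<k. cnj (C i p) * C j p)"
      using inprod_orthonormal_or_zero_coeff[OF e]
      by (intro sum.cong refl arg_cong2[of _ _ _ _ "(*)"]) (auto simp: C_def)
    finally show ?thesis .
  qed
  have "(\<Sum>i<k. \<Sum>j<k. (\<Sum>c<n. A i j c c) * inprod m (v j) (v i))
      = (\<Sum>i<k. \<Sum>j<k. \<Sum>p<k. \<Sum>c<n. cnj (C i p) * A i j c c * C j p)"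
    by (intro sum.cong refl) (simp add: vv sum_distrib_left sum_distrib_right mult_ac)
  also have "\<dots> = (\<Sum>p<k. \<Sum>c<n. \<Sum>i<k. \<Sum>j<k. cnj (C i p) * A i j c c * C j p)"
    by (rule sum_swap_pairs)
  finally have trace: "(\<Sum>i<k. \<Sum>j<k. (\<Sum>c<n. A i j c c) * inprod m (v j) (v i)) = T"
    by (simp add: T_def A'_def)
  have T: "0 \<le> T" and bound: "block_form k n A' b \<le> of_real (\<Sum>p<k. norm_sq n (b p)) * T"
    using block_form_le_trace[OF psd'] by (simp_all add: T_def)
  have "(\<Sum>p<k. norm_sq n (b p)) \<le> \<alpha>"
    using ky_fan[OF e] \<alpha> by (simp add: b_def)
  \<comment> \<open>The factor \<open>T\<close> is the trace of a positive semidefinite family,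
    hence real and nonnegative, so multiplying by it preserves the order on the complex
    numbers.\<close>
  then have "of_real (\<Sum>p<k. norm_sq n (b p)) * T \<le> of_real \<alpha> * T"
    using T by (intro mult_right_mono) (auto simp: less_eq_complex_def)
  then show "0 \<le> of_real \<alpha> * (\<Sum>i<k. \<Sum>j<k. (\<Sum>c<n. A i j c c) * inprod m (v j) (v i))
          - block_form k n A (\<lambda>i. adjoint_apply m B (v i))"
    unfolding trace form using bound by simp
qed

end

theorem corollary4p5:
  fixes m n k :: nat and \<alpha> :: real and B :: "complex mat"
  assumes "m \<ge> 1" and "n \<ge> 1" and "1 \<le> k" and "k \<le> m"
    and "B \<in> carrier_mat m n"
  shows "k_positive n m k (Phi_minus \<alpha> B) \<longleftrightarrow> \<alpha> \<ge> (\<Sum>j = 1..k. (singular_value B j)\<^sup>2)"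
proof -
  obtain lam u where lam: "antimono lam" "\<And>j. 0 \<le> lam j" "\<And>j. n \<le> j \<Longrightarrow> lam j = 0"
    "orthonormal_basis n u"
    "\<And>j c. j < n \<Longrightarrow> c < n \<Longrightarrow>
       adjoint_apply m B (mat_apply n B (u j)) c = of_real (lam j) * u j c"
    and sv: "\<And>j. j < min m n \<Longrightarrow> (singular_value B (Suc j))\<^sup>2 = lam j"
    using singular_value_eigenbasis[OF assms(5)] by metis
  interpret svd m n B lam u
    using lam by unfold_locales auto
  \<comment> \<open>Because of \<open>k \<le> m\<close>, an index \<open>j < k\<close> is either
    below both dimensions or at least \<open>n\<close>; in the latter case both sides are 0.\<close>
  have "(singular_value B (Suc j))\<^sup>2 = lam j" if "j < k" for j
    using that assms(4,5) sv[of j] lam(3)[of j]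
    by (cases "j < n") (auto simp: singular_value_def)
  then have "(\<Sum>j = 1..k. (singular_value B j)\<^sup>2) = (\<Sum>j<k. lam j)"
    unfolding One_nat_def sum.atLeast1_atMost_eq by (intro sum.cong) auto
  then show ?thesis
    using sum_lam_le_of_k_positive[OF assms(5,1,2,3)] k_positive_of_sum_lam_le[OF assms(5)]
    by metis
qed

end
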